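(* Let $(X_t)_{t\in\mathbb Z}$ be a strictly stationary sequence of $\mathbb R^d$-valued random vectors which is regularly varying with index $\alpha>0$, with spectral tail process $(\Theta_t)_{t\in\mathbb Z}$. Let $(\Lambda_n)$ be a sequence of Borel subsets $\Lambda_n\subset(0,\infty)$ such that $x_n=\inf\Lambda_n\to\infty$ and $n\,\mathbb P(|X_0|>x_n)\to0$, and assume the uniform anti-clustering condition $$\lim_{k\to\infty}\limsup_{n\to\infty}\sup_{x\in\Lambda_n}\mathbb P\Big(\max_{k\le i\le n}|X_i|>x\delta\ \Big|\ |X_0|>x\delta\Big)=0\qquad\text{for every }\delta>0 .$$ Let $f$ be a complex-valued function on $(\mathbb R^d)^{\mathbb N}$ satisfying condition $(C_\varepsilon)$ (defined in the context) for some $\varepsilon>0$. Then, as $n\to\infty$, $$\sup_{x\in\Lambda_n}\left|\frac{\mathbb E[f(x^{-1}X_1,\ldots,x^{-1}X_n)]}{n\,\mathbb P(|X_0|>x)}-\int_0^\infty\mathbb E\big[f(y(\Theta_t)_{t\ge0})-f(y(\Theta_t)_{t\ge1})\big]\,d(-y^{-\alpha})\right|\to0 .$$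
   Context: $|\cdot|$ is the Euclidean norm; $d(-y^{-\alpha})=\alpha y^{-\alpha-1}dy$ on $(0,\infty)$. Regular variation. A random vector $V$ is regularly varying with index $\alpha>0$ if there is a random vector $\Theta$ on the unit sphere such that for every $u>0$, $\mathbb P(|V|>ux,\,V/|V|\in\cdot)/\mathbb P(|V|>x)\to u^{-\alpha}\mathbb P(\Theta\in\cdot)$ weakly as $x\to\infty$. A strictly stationary sequence $(X_t)$ is regularly varying with index $\alpha$ if $(X_1,\ldots,X_k)$ is regularly varying with index $\alpha$ for every $k\ge1$. Equivalently, there is a sequence $(Y_t)_{t\in\mathbb Z}$ (the tail process) with $\mathbb P(|Y_0|>y)=y^{-\alpha}$ for $y>1$ and, for every $k\ge0$, $\mathbb P(x^{-1}(X_{-k},\ldots,X_k)\in\cdot\mid|X_0|>x)\to\mathbb P((Y_{-k},\ldots,Y_k)\in\cdot)$ weakly as $x\to\infty$. The spectral tail process is $\Theta_t=Y_t/|Y_0|$, $t\in\mathbb Z$; it is independent of $|Y_0|$, and $|\Theta_0|=1$. Condition $(C_\varepsilon)$. For $l\ge1$, $f_l$ denotes the restriction of $f$ to $(\mathbb R^d)^l$, with $f_0=0$; one writes $f$ for $f_l$ when the number of arguments is clear. Condition $(C_\varepsilon)$ means: the functions $f_l$, $l\ge1$, are a.e. continuous and bounded uniformly in $l$, and for $1\le j_1\le j_2\le l$, $f_l(x_1,\ldots,x_l)=f_{j_2-j_1+1}(x_{j_1},\ldots,x_{j_2})$ whenever $|x_i|\le\varepsilon$ for all $i\in\{1,\ldots,j_1-1\}\cup\{j_2+1,\ldots,l\}$;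 moreover $f_l(x_1,\ldots,x_l)=f_0=0$ if $|x_i|\le\varepsilon$ for all $i$. For an infinite sequence $(x_1,x_2,\ldots)$ with $|x_i|\le\varepsilon$ for all $i>l$, $f(x_1,x_2,\ldots)=f_l(x_1,\ldots,x_l)$. (Under the anti-clustering condition $\Theta_t\to0$ as $t\to\infty$, so this applies to $y(\Theta_t)_{t\ge0}$ and $y(\Theta_t)_{t\ge1}$.)
   Formalization: "A.e. continuous" in (C_ε), for which no measure is named, is read as a.e. for the limit (tail) measure, i.e. at y(Θ_s,…,Θ_{s+l-1}) for a.e. y>0, almost surely, for all s; read with Lebesgue measure the claim fails, e.g. for X_t=Z_t+Z_{t-1}, Z iid Pareto. The f_l are taken Borel. *)

theory Defs
  imports "HOL-Probability.Probability"
begin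

text \<open>
  Processes with values in \<^typ>\<open>'a\<close> are indexed by \<^typ>\<open>int\<close>.  A vector
  \<open>(v\<^sub>i)\<^sub>i\<^sub>\<in>\<^sub>I\<close> with \<open>I\<close> a finite set of integers is represented by the function
  \<open>int \<Rightarrow> 'a\<close> that vanishes off \<open>I\<close>; for the product topology these functions form a closed
  copy of \<open>'a\<^sup>I\<close>, onto which \<open>int \<Rightarrow> 'a\<close> retracts continuously, so that weak convergence
  there is weak convergence on \<open>'a\<^sup>I\<close>.
\<close>

definition window :: "int set \<Rightarrow> (int \<Rightarrow> 'w \<Rightarrow> 'a::zero) \<Rightarrow> 'w \<Rightarrow> int \<Rightarrow> 'a" where
  "window I X \<omega> = (\<lambda>i. if i \<in> I then X i \<omega> else 0)"

definition window_norm :: "int set \<Rightarrow> (int \<Rightarrow> 'a::real_normed_vector) \<Rightarrow> real" where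
  "window_norm I v = L2_set (\<lambda>i. norm (v i)) I"

definition converges_weakly ::
  "('i \<Rightarrow> 'b::topological_space measure) \<Rightarrow> 'b measure \<Rightarrow> 'i filter \<Rightarrow> bool" where
  "converges_weakly \<mu> \<nu> F \<longleftrightarrow>
     (\<forall>g :: 'b \<Rightarrow> real. continuous_on UNIV g \<and> bounded (range g) \<longrightarrow>
        ((\<lambda>i. integral\<^sup>L (\<mu> i) g) \<longlongrightarrow> integral\<^sup>L \<nu> g) F)"

definition strictly_stationary :: "'w measure \<Rightarrow> (int \<Rightarrow> 'w \<Rightarrow> 'a::euclidean_space) \<Rightarrow> bool" where
  "strictly_stationary M X \<longleftrightarrow>
     (\<forall>h. distr M borel (\<lambda>\<omega> t. X (t + h) \<omega>) = distr M borel (\<lambda>\<omega> t. X t \<omega>))"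

text \<open>Here \<open>S\<close> is the law of the random vector on the unit sphere.\<close>

definition regularly_varying_vector ::
  "'w measure \<Rightarrow> real \<Rightarrow> int set \<Rightarrow> (int \<Rightarrow> 'w \<Rightarrow> 'a::euclidean_space) \<Rightarrow> bool" where
  "regularly_varying_vector M \<alpha> I X \<longleftrightarrow> \<alpha> > 0 \<and>
     (\<exists>S :: (int \<Rightarrow> 'a) measure. prob_space S \<and> sets S = sets borel \<and>
        (AE z in S. window_norm I z = 1 \<and> (\<forall>i. i \<notin> I \<longrightarrow> z i = 0)) \<and>
        (\<forall>u>0. converges_weakly
           (\<lambda>x::real. scale_measure
              (ennreal (1 / \<P>(\<omega> in M. window_norm I (window I X \<omega>) > x)))
              (distr (restrict_space M {\<omega> \<in> space M. window_norm I (window I X \<omega>) > u * x}) borel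
                (\<lambda>\<omega> i. window I X \<omega> i /\<^sub>R window_norm I (window I X \<omega>))))
           (scale_measure (ennreal (u powr (- \<alpha>))) S) at_top))"

definition regularly_varying_sequence ::
  "'w measure \<Rightarrow> real \<Rightarrow> (int \<Rightarrow> 'w \<Rightarrow> 'a::euclidean_space) \<Rightarrow> bool" where
  "regularly_varying_sequence M \<alpha> X \<longleftrightarrow>
     (\<forall>k\<ge>1::nat. regularly_varying_vector M \<alpha> {1..int k} X)"

definition tail_process ::
  "'w measure \<Rightarrow> real \<Rightarrow> (int \<Rightarrow> 'w \<Rightarrow> 'a::euclidean_space) \<Rightarrow> 'v measure \<Rightarrow> (int \<Rightarrow> 'v \<Rightarrow> 'a) \<Rightarrow> bool"
  where
  "tail_process M \<alpha> X N Y \<longleftrightarrow> prob_space N \<and> (\<forall>t. Y t \<in> borel_measurable N) \<and>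
     (\<forall>y>1. \<P>(\<omega> in N. norm (Y 0 \<omega>) > y) = y powr (- \<alpha>)) \<and>
     (\<forall>k::nat. converges_weakly
        (\<lambda>x::real. distr (uniform_measure M {\<omega> \<in> space M. norm (X 0 \<omega>) > x}) borel
           (window {- int k..int k} (\<lambda>t \<omega>. X t \<omega> /\<^sub>R x)))
        (distr N borel (window {- int k..int k} Y)) at_top)"

definition spectral_tail_process ::
  "'w measure \<Rightarrow> real \<Rightarrow> (int \<Rightarrow> 'w \<Rightarrow> 'a::euclidean_space) \<Rightarrow> 'v measure \<Rightarrow> (int \<Rightarrow> 'v \<Rightarrow> 'a) \<Rightarrow> bool"
  where
  "spectral_tail_process M \<alpha> X N \<Theta> \<longleftrightarrow>
     (\<exists>Y. tail_process M \<alpha> X N Y \<and> \<Theta> = (\<lambda>t \<omega>. Y t \<omega> /\<^sub>R norm (Y 0 \<omega>)))"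

text \<open>
  The family \<open>(f\<^sub>l)\<close> is a single function on lists, \<open>f\<^sub>l\<close> being its restriction to
  lists of length \<open>l\<close>.  Below, \<^term>\<open>restriction f l\<close> is \<open>f\<^sub>l\<close> read as a function of
  the first \<open>l\<close> coordinates of a sequence, so its continuity and Borel measurability for the
  product topology are those of \<open>f\<^sub>l\<close>.
\<close>

definition restriction :: "('a list \<Rightarrow> complex) \<Rightarrow> nat \<Rightarrow> (nat \<Rightarrow> 'a) \<Rightarrow> complex" where
  "restriction f l x = f (map x [0..<l])"

text \<open>
  Almost everywhere continuity refers to the tail measure of the stationary sequence, i.e. the
  image of \<open>d(-y\<^sup>-\<^sup>\<alpha>) \<otimes> P\<close> under \<open>(y, \<omega>) \<mapsto> y \<Theta>(\<omega>)\<close>, and its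
  finite-dimensional windows.  Lebesgue-almost everywhere continuity would not do:
  the tail measure of the windows is in general singular (for \<open>X\<^sub>t = Z\<^sub>t + Z\<^sub>t\<^sub>-\<^sub>1\<close> with
  iid Pareto \<open>Z\<^sub>t\<close> it charges the diagonals), and a functional whose discontinuities fill that
  Lebesgue null set has a different limit.  On \<open>(0,\<infinity>)\<close> the measure
  \<open>d(-y\<^sup>-\<^sup>\<alpha>)\<close> has the null sets of Lebesgue measure.
\<close>

definition ae_continuous ::
  "'v measure \<Rightarrow> (int \<Rightarrow> 'v \<Rightarrow> 'a::euclidean_space) \<Rightarrow> nat \<Rightarrow> ((nat \<Rightarrow> 'a) \<Rightarrow> complex) \<Rightarrow> bool" where
  "ae_continuous N \<Theta> l h \<longleftrightarrow>
     (\<forall>s::int. AE y in lborel. y > 0 \<longrightarrow>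
        (AE \<omega> in N. isCont h (\<lambda>i. if i < l then y *\<^sub>R \<Theta> (s + int i) \<omega> else 0)))"

text \<open>
  List positions are counted from 0.
\<close>

definition condition_C ::
  "'v measure \<Rightarrow> (int \<Rightarrow> 'v \<Rightarrow> 'a::euclidean_space) \<Rightarrow> real \<Rightarrow> ('a list \<Rightarrow> complex) \<Rightarrow> bool" where
  "condition_C N \<Theta> \<epsilon> f \<longleftrightarrow>
     f [] = 0 \<and>
     (\<forall>l\<ge>1. restriction f l \<in> borel_measurable borel \<and> ae_continuous N \<Theta> l (restriction f l)) \<and>
     (\<exists>C. \<forall>xs. norm (f xs) \<le> C) \<and>
     (\<forall>xs j1 j2. 1 \<le> j1 \<and> j1 \<le> j2 \<and> j2 \<le> length xs \<and>
        (\<forall>i \<in> {1..j1 - 1} \<union> {j2 + 1..length xs}. norm (xs ! (i - 1)) \<le> \<epsilon>) \<longrightarrow>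
        f xs = f (map (\<lambda>i. xs ! (i - 1)) [j1..<j2 + 1])) \<and>
     (\<forall>xs. (\<forall>x \<in> set xs. norm x \<le> \<epsilon>) \<longrightarrow> f xs = 0)"

text \<open>
  Under the condition above any \<open>l\<close> with \<open>\<bar>x\<^sub>i\<bar> \<le> \<epsilon>\<close> from position \<open>l\<close> on
  gives the same value as the least one.  The value 0 is only a convention for sequences outside the
  domain of the extension.
\<close>

definition seq_ext ::
  "real \<Rightarrow> ('a::real_normed_vector list \<Rightarrow> complex) \<Rightarrow> (nat \<Rightarrow> 'a) \<Rightarrow> complex" where
  "seq_ext \<epsilon> f x =
     (if \<exists>l. \<forall>i\<ge>l. norm (x i) \<le> \<epsilon>
      then restriction f (LEAST l. \<forall>i\<ge>l. norm (x i) \<le> \<epsilon>) x else 0)"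

definition uniform_anti_clustering ::
  "'w measure \<Rightarrow> (int \<Rightarrow> 'w \<Rightarrow> 'a::real_normed_vector) \<Rightarrow> (nat \<Rightarrow> real set) \<Rightarrow> bool" where
  "uniform_anti_clustering M X \<Lambda> \<longleftrightarrow>
     (\<forall>\<delta>>0. (\<lambda>k::nat. limsup (\<lambda>n. SUP x \<in> \<Lambda> n.
        ennreal (\<P>(\<omega> in M. (\<exists>i\<in>{k..n}. norm (X (int i) \<omega>) > x * \<delta>) \<bar> norm (X 0 \<omega>) > x * \<delta>))))
        \<longlonglongrightarrow> 0)"

end

theory Submission
  imports Defs
begin

text \<open>
  Telescoping over the starting point of a block and using stationarity,
  \<open>E f(X\<^sub>1/x, \<dots>, X\<^sub>n/x)\<close> is the sum over \<open>m < n\<close> of the means of the increments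
  \<open>f(X\<^sub>0/x, \<dots>, X\<^sub>m/x) - f(X\<^sub>1/x, \<dots>, X\<^sub>m/x)\<close>, which vanish unless \<open>|X\<^sub>0| > \<epsilon>x\<close>.
  Uniformly in \<open>x \<in> \<Lambda>\<^sub>n\<close>, anti-clustering lets one replace all of them by the \<open>k\<close>-th one,
  for \<open>k\<close> fixed but large, at a cost negligible with respect to \<open>n P(|X\<^sub>0| > x)\<close>.
  The \<open>k\<close>-th increment is an almost everywhere continuous functional of finitely many
  coordinates, so its normalised mean converges as \<open>x \<rightarrow> \<infinity>\<close>; the limit is written as an integral
  with respect to \<open>d(-y\<^sup>-\<^sup>\<alpha>)\<close> because \<open>|Y\<^sub>0|\<close> is Pareto distributed and independent of \<open>\<Theta>\<close>.
  Anti-clustering also forces \<open>\<Theta>\<^sub>t \<rightarrow> 0\<close>, hence dominated convergence applies as \<open>k \<rightarrow> \<infinity>\<close>.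
\<close>

section \<open>Weak convergence on metric spaces\<close>

text \<open>The tail process is a limit given \<open>norm (X 0) > x\<close>, whereas an increment
  lives on \<open>norm (X 0) > \<epsilon> * x\<close>, a larger event when
  \<open>\<epsilon> < 1\<close>. Conditioning is therefore done at level
  \<open>\<epsilon> * x\<close>: the limit is a mean of the increment at \<open>\<epsilon>\<close>
  times \<open>Y\<close>, whose radius is Pareto on the half-line from \<open>\<epsilon>\<close>,
  and the ratio of the tail probabilities at \<open>\<epsilon> * x\<close> and \<open>x\<close>
  contributes \<open>\<epsilon> powr (- \<alpha>)\<close>, which cancels the normalising constant of
  that law. Independence of \<open>norm (Y 0)\<close> and the spectral process is not a clause of
  \<open>tail_process\<close>; it is derived from the convergence of the windows. Since
  \<open>f\<close> is only almost everywhere continuous, weak convergence is first strengthened to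
  functionals whose discontinuities are null for the limit. Anti-clustering acts at level
  \<open>\<delta> = \<epsilon>\<close> when increments are compared and at all small
  \<open>\<delta>\<close> for the decay of \<open>\<Theta>\<close>. In the comparison the
  \<open>k\<close> early increments cost a multiple of \<open>real k / real n\<close>, the others an
  arbitrarily small constant, so \<open>k\<close> is fixed before \<open>n\<close> grows.\<close>

definition lipschitz_envelope :: "('b::metric_space \<Rightarrow> real) \<Rightarrow> nat \<Rightarrow> 'b \<Rightarrow> real" where
  "lipschitz_envelope h k x = (INF y. h y + real k * dist x y)"

text \<open>\<open>lipschitz_envelope h k\<close> is the infimal convolution of \<open>h\<close>
  with \<open>k\<close> times the distance, the largest \<open>k\<close>-Lipschitz minorant of
  \<open>h\<close>; it supplies continuous test functions from below. At a continuity point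
  \<open>x\<close> only \<open>y\<close> near \<open>x\<close> matter for large \<open>k\<close>,
  because a distant \<open>y\<close> pays a penalty exceeding \<open>2 * C\<close>, the largest
  possible drop of \<open>h\<close>.\<close>

lemma
  fixes h :: "'b::metric_space \<Rightarrow> real"
  assumes bd: "\<And>x. \<bar>h x\<bar> \<le> C"
  shows lipschitz_envelope_le: "lipschitz_envelope h k x \<le> h x"
    and lipschitz_envelope_bounded: "\<bar>lipschitz_envelope h k x\<bar> \<le> C"
    and lipschitz_envelope_continuous: "continuous_on UNIV (lipschitz_envelope h k)"
    and lipschitz_envelope_tendsto: "isCont h x \<Longrightarrow> (\<lambda>k. lipschitz_envelope h k x) \<longlonglongrightarrow> h x"
proof -
  let ?H = "lipschitz_envelope h"
  have ge: "- C \<le> h y + real k * dist x y" for x y k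
  proof -
    have "0 \<le> real k * dist x y"
      by simp
    then show ?thesis
      using bd[of y] by linarith
  qed
  have bb: "bdd_below (range (\<lambda>y. h y + real k * dist x y))" for x k
    using ge by (intro bdd_belowI[of _ "- C"]) auto
  have low: "?H k x \<le> h y + real k * dist x y" for k x y
    unfolding lipschitz_envelope_def by (rule cINF_lower[OF bb]) simp
  have great: "c \<le> ?H k x" if "\<And>y. c \<le> h y + real k * dist x y" for c k x
    unfolding lipschitz_envelope_def by (rule cINF_greatest) (use that in auto)
  have le: "?H k x \<le> h x" for k x
    using low[of k x x] by simp
  show "?H k x \<le> h x"
    by (rule le)
  show "\<bar>?H k x\<bar> \<le> C"
    using le[of k x] bd[of x] great[of "- C" k x] ge[of _ k x] by (simp add: abs_le_iff)
  have lip: "?H k x \<le> ?H k z + real k * dist x z" for k x z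
  proof -
    have "?H k x - real k * dist x z \<le> ?H k z"
    proof (rule great)
      fix y
      have "real k * dist x y \<le> real k * dist x z + real k * dist z y"
        by (metis dist_triangle distrib_left mult_left_mono of_nat_0_le_iff)
      then show "?H k x - real k * dist x z \<le> h y + real k * dist z y"
        using low[of k x y] by linarith
    qed
    then show ?thesis
      by linarith
  qed
  have lip': "dist (?H k x) (?H k z) \<le> real k * dist x z" for k x z
    using lip[of k x z] lip[of k z x] by (simp add: dist_real_def dist_commute abs_le_iff)
  show "continuous_on UNIV (?H k)"
    using lip' by (intro lipschitz_on_continuous_on[of "real k"] lipschitz_onI) auto
  show "(\<lambda>k. ?H k x) \<longlonglongrightarrow> h x" if "isCont h x"
  proof (rule tendstoI)
    fix e :: real assume "e > 0"
    with that obtain d where d: "d > 0" "\<And>y. dist y x < d \<Longrightarrow> dist (h y) (h x) < e / 2"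
      unfolding continuous_at_eps_delta by (metis half_gt_zero)
    obtain K :: nat where K: "2 * C / d \<le> real K"
      using real_arch_simple by blast
    have "dist (?H k x) (h x) < e" if "k \<ge> K" for k
    proof -
      have "h x - e / 2 \<le> ?H k x"
      proof (rule great)
        fix y
        show "h x - e / 2 \<le> h y + real k * dist x y"
        proof (cases "dist y x < d")
          case True
          have "0 \<le> real k * dist x y"
            by simp
          then show ?thesis
            using d(2)[OF True] unfolding dist_real_def by linarith
        next
          case False
          have "2 * C \<le> real K * d"
            using K d(1) by (simp add: field_simps)
          also have "\<dots> \<le> real k * dist x y"
            using False that d(1) by (intro mult_mono) (auto simp: dist_commute)
          finally show ?thesis
            using bd[of x] bd[of y] \<open>e > 0\<close> by (simp add: abs_le_iff)
        qed
      qed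
      then show ?thesis
        using le[of k x] \<open>e > 0\<close> by (simp add: dist_real_def)
    qed
    then show "\<forall>\<^sub>F k in sequentially. dist (?H k x) (h x) < e"
      by (auto simp: eventually_at_top_linorder)
  qed
qed

lemma integrable_bounded_borel:
  fixes h :: "'b::topological_space \<Rightarrow> 'c::{banach, second_countable_topology}"
  assumes "finite_measure \<mu>" "sets \<mu> = sets borel" "h \<in> borel_measurable borel" "\<And>x. norm (h x) \<le> C"
  shows "integrable \<mu> h"
  by (intro finite_measure.integrable_const_bound[OF assms(1), of _ C])
     (use assms in \<open>auto cong: measurable_cong_sets\<close>)

lemma norm_integral_le_integral:
  fixes f :: "'w \<Rightarrow> 'b::{banach, second_countable_topology}" and g :: "'w \<Rightarrow> real"
  assumes "integrable M f" "integrable M g" "\<And>x. x \<in> space M \<Longrightarrow> norm (f x) \<le> g x"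
  shows "norm (integral\<^sup>L M f) \<le> integral\<^sup>L M g"
proof -
  have "norm (integral\<^sup>L M f) \<le> (\<integral>x. norm (f x) \<partial>M)"
    by (rule integral_norm_bound)
  also have "\<dots> \<le> integral\<^sup>L M g"
    by (intro integral_mono integrable_norm assms)
  finally show ?thesis .
qed

text \<open>The Lipschitz envelopes increase to \<open>h\<close> at its continuity points only, which is all that
  the lower bound needs.\<close>

lemma converges_weakly_eventually_less:
  fixes h :: "'b::metric_space \<Rightarrow> real"
  assumes w: "converges_weakly \<mu> \<nu> F"
    and fin: "\<forall>\<^sub>F i in F. finite_measure (\<mu> i)" "\<And>i. sets (\<mu> i) = sets borel"
    and nu: "finite_measure \<nu>" "sets \<nu> = sets borel"
    and h: "h \<in> borel_measurable borel" "\<And>x. \<bar>h x\<bar> \<le> C" "AE x in \<nu>. isCont h x"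
    and e: "e > 0"
  shows "\<forall>\<^sub>F i in F. integral\<^sup>L \<nu> h - e < integral\<^sup>L (\<mu> i) h"
proof -
  define H where "H = lipschitz_envelope h"
  have env: "H k x \<le> h x" "\<bar>H k x\<bar> \<le> C" "continuous_on UNIV (H k)"
      "isCont h x \<Longrightarrow> (\<lambda>k. H k x) \<longlonglongrightarrow> h x" for k x
    unfolding H_def using lipschitz_envelope_le[of h C k x] lipschitz_envelope_bounded[of h C k x]
      lipschitz_envelope_continuous[of h C k] lipschitz_envelope_tendsto[of h C x] h(2) by blast+
  have Hm: "H k \<in> borel_measurable borel" for k
    using env(3) by (rule borel_measurable_continuous_onI)
  interpret nu: finite_measure \<nu> by fact
  have "(\<lambda>k. integral\<^sup>L \<nu> (H k)) \<longlonglongrightarrow> integral\<^sup>L \<nu> h"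
    by (rule integral_dominated_convergence[where w="\<lambda>_. C"])
       (use nu h Hm env in \<open>auto cong: measurable_cong_sets\<close>)
  then have "\<forall>\<^sub>F k in sequentially. integral\<^sup>L \<nu> h - e / 2 < integral\<^sup>L \<nu> (H k)"
    using e by (intro order_tendstoD) auto
  then obtain k where k: "integral\<^sup>L \<nu> h - e / 2 < integral\<^sup>L \<nu> (H k)"
    by (auto simp: eventually_at_top_linorder)
  have "bounded (range (H k))"
    using env(2) by (auto intro!: boundedI[of _ C])
  with w env(3) have "((\<lambda>i. integral\<^sup>L (\<mu> i) (H k)) \<longlongrightarrow> integral\<^sup>L \<nu> (H k)) F"
    unfolding converges_weakly_def by blast
  then have "\<forall>\<^sub>F i in F. integral\<^sup>L \<nu> (H k) - e / 2 < integral\<^sup>L (\<mu> i) (H k)"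
    using e by (intro order_tendstoD) auto
  with fin(1) show ?thesis
  proof eventually_elim
    case (elim i)
    have "integral\<^sup>L (\<mu> i) (H k) \<le> integral\<^sup>L (\<mu> i) h"
      by (intro integral_mono integrable_bounded_borel[where C=C])
         (use elim fin(2) h Hm env in auto)
    with elim k show ?case by linarith
  qed
qed

text \<open>The lower bound applied to \<open>h\<close> and to \<open>- h\<close>; the hypotheses on
  \<open>h\<close> are symmetric under negation.\<close>

lemma converges_weakly_tendsto_real:
  fixes h :: "'b::metric_space \<Rightarrow> real"
  assumes w: "converges_weakly \<mu> \<nu> F"
    and fin: "\<forall>\<^sub>F i in F. finite_measure (\<mu> i)" "\<And>i. sets (\<mu> i) = sets borel"
    and nu: "finite_measure \<nu>" "sets \<nu> = sets borel"
    and h: "h \<in> borel_measurable borel" "\<And>x. \<bar>h x\<bar> \<le> C" "AE x in \<nu>. isCont h x"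
  shows "((\<lambda>i. integral\<^sup>L (\<mu> i) h) \<longlongrightarrow> integral\<^sup>L \<nu> h) F"
proof (rule tendstoI)
  fix e :: real assume e: "e > 0"
  have "\<forall>\<^sub>F i in F. integral\<^sup>L \<nu> (\<lambda>x. - h x) - e < integral\<^sup>L (\<mu> i) (\<lambda>x. - h x)"
    by (rule converges_weakly_eventually_less[OF w fin nu _ _ _ e, of _ C]) (use h in auto)
  moreover have "\<forall>\<^sub>F i in F. integral\<^sup>L \<nu> h - e < integral\<^sup>L (\<mu> i) h"
    by (rule converges_weakly_eventually_less[OF w fin nu h e])
  ultimately show "\<forall>\<^sub>F i in F. dist (integral\<^sup>L (\<mu> i) h) (integral\<^sup>L \<nu> h) < e"
    by eventually_elim (simp add: dist_real_def abs_less_iff)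
qed

text \<open>Real and imaginary parts are treated separately. Finiteness of \<open>\<mu> i\<close> is
  asked only eventually, because a conditional law is a probability measure only while the
  conditioning event has positive probability.\<close>

lemma converges_weakly_tendsto:
  fixes h :: "'b::metric_space \<Rightarrow> complex"
  assumes w: "converges_weakly \<mu> \<nu> F"
    and fin: "\<forall>\<^sub>F i in F. finite_measure (\<mu> i)" "\<And>i. sets (\<mu> i) = sets borel"
    and nu: "finite_measure \<nu>" "sets \<nu> = sets borel"
    and h: "h \<in> borel_measurable borel" "\<And>x. norm (h x) \<le> C" "AE x in \<nu>. isCont h x"
  shows "((\<lambda>i. integral\<^sup>L (\<mu> i) h) \<longlongrightarrow> integral\<^sup>L \<nu> h) F"
proof -
  have int: "integrable \<rho> h" if "finite_measure \<rho>" "sets \<rho> = sets borel" for \<rho> :: "'b measure"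
    by (rule integrable_bounded_borel[OF that h(1,2)])
  have bd: "\<bar>Re (h x)\<bar> \<le> C" "\<bar>Im (h x)\<bar> \<le> C" for x
    using abs_Re_le_cmod[of "h x"] abs_Im_le_cmod[of "h x"] h(2)[of x] by auto
  have [measurable]: "h \<in> borel_measurable borel" by (rule h(1))
  have "((\<lambda>i. \<integral>x. Re (h x) \<partial>\<mu> i) \<longlongrightarrow> (\<integral>x. Re (h x) \<partial>\<nu>)) F"
    by (rule converges_weakly_tendsto_real[OF w fin nu _ bd(1)]) (use h(3) in \<open>auto intro: isCont_Re\<close>)
  moreover have "((\<lambda>i. \<integral>x. Im (h x) \<partial>\<mu> i) \<longlongrightarrow> (\<integral>x. Im (h x) \<partial>\<nu>)) F"
    by (rule converges_weakly_tendsto_real[OF w fin nu _ bd(2)]) (use h(3) in \<open>auto intro: isCont_Im\<close>)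
  ultimately have "((\<lambda>i. Complex (\<integral>x. Re (h x) \<partial>\<mu> i) (\<integral>x. Im (h x) \<partial>\<mu> i))
      \<longlongrightarrow> Complex (\<integral>x. Re (h x) \<partial>\<nu>) (\<integral>x. Im (h x) \<partial>\<nu>)) F"
    by (rule tendsto_Complex)
  moreover have "\<forall>\<^sub>F i in F. Complex (\<integral>x. Re (h x) \<partial>\<mu> i) (\<integral>x. Im (h x) \<partial>\<mu> i) = integral\<^sup>L (\<mu> i) h"
    using fin(1) by eventually_elim (simp add: complex_eq_iff int fin(2))
  moreover have "Complex (\<integral>x. Re (h x) \<partial>\<nu>) (\<integral>x. Im (h x) \<partial>\<nu>) = integral\<^sup>L \<nu> h"
    using int nu by (simp add: complex_eq_iff)
  ultimately show ?thesis
    using Lim_transform_eventually by fastforce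
qed

text \<open>The indicator of a closed set is a decreasing limit of continuous functions of the
  distance to it, and closed sets form an intersection-stable generator of the Borel sets.\<close>

lemma measure_eqI_bounded_continuous:
  fixes \<mu> \<nu> :: "'b::metric_space measure"
  assumes fin: "finite_measure \<mu>" "finite_measure \<nu>"
    and sets: "sets \<mu> = sets borel" "sets \<nu> = sets borel"
    and eq: "\<And>g :: 'b \<Rightarrow> real. continuous_on UNIV g \<Longrightarrow> bounded (range g) \<Longrightarrow> integral\<^sup>L \<mu> g = integral\<^sup>L \<nu> g"
  shows "\<mu> = \<nu>"
proof -
  interpret mu: finite_measure \<mu> by fact
  interpret nu: finite_measure \<nu> by fact
  have closed: "measure \<mu> A = measure \<nu> A" if A: "closed A" for A
  \<comment> \<open>The distance \<open>infdist x {}\<close> is 0 by convention, so the functions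
    \<open>g k\<close> below would not decrease to the indicator of the empty set.\<close>
  proof (cases "A = {}")
    case False
    define g where "g = (\<lambda>(k::nat) x. max 0 (1 - real k * infdist x A))"
    have cont: "continuous_on UNIV (g k)" for k
      unfolding g_def by (intro continuous_intros)
    have g01: "0 \<le> g k x" "g k x \<le> 1" for k x
      using infdist_nonneg[of x A] by (auto simp: g_def)
    have bdd: "bounded (range (g k))" for k
      using g01 by (auto intro!: boundedI[of _ 1])
    have lim: "(\<lambda>k. g k x) \<longlonglongrightarrow> indicator A x" for x
    proof (cases "x \<in> A")
      case True
      then show ?thesis by (simp add: g_def)
    next
      case False
      then have pos: "infdist x A > 0"
        using A \<open>A \<noteq> {}\<close> by (simp add: infdist_pos_not_in_closed)
      obtain K :: nat where K: "1 / infdist x A \<le> real K"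
        using real_arch_simple by blast
      have "g k x = 0" if "k \<ge> K" for k
      proof -
        have "1 / infdist x A \<le> real k"
          using K that by (meson of_nat_mono order_trans)
        then show ?thesis
          using pos by (simp add: g_def field_simps)
      qed
      then show ?thesis
        using False by (intro tendsto_eventually) (auto simp: eventually_at_top_linorder)
    qed
    have conv: "(\<lambda>k. integral\<^sup>L \<rho> (g k)) \<longlonglongrightarrow> measure \<rho> A"
      if "finite_measure \<rho>" "sets \<rho> = sets borel" for \<rho> :: "'b measure"
    proof -
      interpret finite_measure \<rho> by fact
      have "(\<lambda>k. integral\<^sup>L \<rho> (g k)) \<longlonglongrightarrow> integral\<^sup>L \<rho> (indicator A)"
        by (rule integral_dominated_convergence[where w="\<lambda>_. 1"])
           (use that A g01 lim borel_measurable_continuous_onI[OF cont] in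
             \<open>auto cong: measurable_cong_sets\<close>)
      moreover have "A \<in> sets \<rho>"
        using A that by simp
      ultimately show ?thesis
        by (simp add: sets.Int_space_eq2)
    qed
    have "(\<lambda>k. integral\<^sup>L \<mu> (g k)) \<longlonglongrightarrow> measure \<nu> A"
      using conv[OF fin(2) sets(2)] eq[OF cont bdd] by simp
    then show ?thesis
      using conv[OF fin(1) sets(1)] LIMSEQ_unique by blast
  qed simp
  show ?thesis
  proof (rule measure_eqI_generator_eq[where \<Omega>=UNIV and E="Collect closed" and A="\<lambda>_. UNIV"])
    show "Int_stable (Collect (closed :: 'b set \<Rightarrow> bool))"
      by (auto simp: Int_stable_def)
    show "emeasure \<mu> A = emeasure \<nu> A" if "A \<in> Collect closed" for A
      using closed[of A] that by (simp add: mu.emeasure_eq_measure nu.emeasure_eq_measure)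
    show "sets \<mu> = sigma_sets UNIV (Collect closed)" "sets \<nu> = sigma_sets UNIV (Collect closed)"
      unfolding sets borel_eq_closed by auto
  qed auto
qed

section \<open>The Pareto law\<close>

text \<open>The law of \<open>c\<close> times a standard Pareto variable. Up to the factor
  \<open>c powr \<alpha>\<close> it is the restriction to \<open>{c<..}\<close> of the measure in
  the limit integral, which has infinite mass near 0.\<close>

definition pareto :: "real \<Rightarrow> real \<Rightarrow> real measure" where
  "pareto c \<alpha> = density lborel (\<lambda>x. ennreal (indicator {c<..} x * (\<alpha> * c powr \<alpha> * x powr (- \<alpha> - 1))))"

lemma sets_pareto [simp, measurable_cong]: "sets (pareto c \<alpha>) = sets borel"
  and space_pareto [simp]: "space (pareto c \<alpha>) = UNIV"
  by (simp_all add: pareto_def)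

lemma emeasure_pareto_Ioi:
  assumes c: "c > 0" and \<alpha>: "\<alpha> > 0"
  shows "emeasure (pareto c \<alpha>) {x<..} = ennreal ((c / max c x) powr \<alpha>)"
proof -
  define a where "a = max c x"
  define g where "g = (\<lambda>z::real. \<alpha> * c powr \<alpha> * z powr (- \<alpha> - 1))"
  have a: "a > 0" "a \<ge> c" "a \<ge> x"
    using c by (auto simp: a_def)
  have [measurable]: "g \<in> borel_measurable borel"
    unfolding g_def by measurable
  have "emeasure (pareto c \<alpha>) {x<..}
      = (\<integral>\<^sup>+z. ennreal (indicator {c<..} z * g z) * indicator {x<..} z \<partial>lborel)"
    unfolding pareto_def g_def by (subst emeasure_density) auto
  \<comment> \<open>The two cutoffs combine to the open half-line from \<open>a\<close>; the
    endpoint is a null set, and the fundamental theorem of calculus is applied on the closed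
    half-line.\<close>
  also have "\<dots> = (\<integral>\<^sup>+z. ennreal (g z) * indicator {a..} z \<partial>lborel)"
  proof (rule nn_integral_cong_AE)
    show "AE z in lborel. ennreal (indicator {c<..} z * g z) * indicator {x<..} z
        = ennreal (g z) * indicator {a..} z"
      using AE_lborel_singleton[of a] by eventually_elim (auto simp: a_def indicator_def)
  qed
  also have "\<dots> = ennreal (0 - (- (c powr \<alpha>) * a powr (- \<alpha>)))"
  proof (rule nn_integral_FTC_atLeast)
    show "DERIV (\<lambda>z. - (c powr \<alpha>) * z powr (- \<alpha>)) z :> g z" if "a \<le> z" for z
      using a that unfolding g_def by (auto intro!: derivative_eq_intros simp: powr_diff)
    show "((\<lambda>z. - (c powr \<alpha>) * z powr (- \<alpha>)) \<longlongrightarrow> 0) at_top"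
      by (intro tendsto_mult_right_zero tendsto_neg_powr filterlim_ident) (use \<alpha> in auto)
  qed (use \<alpha> in \<open>auto simp: g_def\<close>)
  also have "0 - (- (c powr \<alpha>) * a powr (- \<alpha>)) = (c / a) powr \<alpha>"
    using a c by (simp add: powr_divide powr_minus_divide)
  finally show ?thesis
    by (simp add: a_def)
qed

lemma prob_space_pareto:
  assumes "c > 0" "\<alpha> > 0"
  shows "prob_space (pareto c \<alpha>)"
proof
  have "AE x in pareto c \<alpha>. x \<in> {c<..}"
    unfolding pareto_def by (subst AE_density) (auto simp: indicator_def)
  then have "emeasure (pareto c \<alpha>) (space (pareto c \<alpha>)) = emeasure (pareto c \<alpha>) {c<..}"
    by (intro emeasure_eq_AE) auto
  also have "\<dots> = 1"
    using emeasure_pareto_Ioi[OF assms, of c] assms by simp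
  finally show "emeasure (pareto c \<alpha>) (space (pareto c \<alpha>)) = 1" .
qed

lemma AE_pareto_iff:
  assumes "c > 0" "\<alpha> > 0"
  shows "(AE x in pareto c \<alpha>. P x) \<longleftrightarrow> (AE x in lborel. c < x \<longrightarrow> P x)"
proof -
  have "0 < indicator {c<..} x * (\<alpha> * c powr \<alpha> * x powr (- \<alpha> - 1)) \<longleftrightarrow> c < x" for x :: real
    using assms by (auto simp: indicator_def)
  then show ?thesis
    unfolding pareto_def by (subst AE_density) auto
qed

text \<open>Since \<open>h\<close> vanishes on \<open>(0, c]\<close>, the integral over
  \<open>{0<..}\<close> is one against a multiple of a probability measure. With
  \<open>c = \<epsilon>\<close> this makes bounded integrands harmless despite the infinite mass
  near 0.\<close>

lemma integral_pareto:
  fixes h :: "real \<Rightarrow> complex"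
  assumes "c > 0" "\<alpha> > 0" and [measurable]: "h \<in> borel_measurable borel"
    and h: "\<And>x. 0 < x \<Longrightarrow> x \<le> c \<Longrightarrow> h x = 0"
  shows "integral\<^sup>L (pareto c \<alpha>) h
    = (c powr \<alpha>) *\<^sub>R (LINT x:{0<..}|lborel. (\<alpha> * x powr (- \<alpha> - 1)) *\<^sub>R h x)"
proof -
  have "integral\<^sup>L (pareto c \<alpha>) h
      = (LINT x|lborel. (indicator {c<..} x * (\<alpha> * c powr \<alpha> * x powr (- \<alpha> - 1))) *\<^sub>R h x)"
    unfolding pareto_def by (rule integral_density) (use assms in auto)
  also have "\<dots> = (LINT x|lborel. (c powr \<alpha>) *\<^sub>R (indicator {0<..} x *\<^sub>R (\<alpha> * x powr (- \<alpha> - 1)) *\<^sub>R h x))"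
  proof (rule Bochner_Integration.integral_cong)
    show "(indicator {c<..} x * (\<alpha> * c powr \<alpha> * x powr (- \<alpha> - 1))) *\<^sub>R h x
        = (c powr \<alpha>) *\<^sub>R (indicator {0<..} x *\<^sub>R (\<alpha> * x powr (- \<alpha> - 1)) *\<^sub>R h x)" for x
      using h[of x] assms(1) by (cases "0 < x"; cases "c < x") (auto simp: mult_ac)
  qed simp
  also have "\<dots> = (c powr \<alpha>) *\<^sub>R (LINT x|lborel. indicator {0<..} x *\<^sub>R (\<alpha> * x powr (- \<alpha> - 1)) *\<^sub>R h x)"
    by (simp only: integral_scaleR_right)
  finally show ?thesis
    by (simp only: set_lebesgue_integral_def)
qed

section \<open>The tail process and its polar decomposition\<close>

text \<open>A cutoff adds discontinuities only on the level set \<open>a v = y\<close>; below the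
  level the function is locally zero, so \<open>b\<close> has to be continuous only above it. The
  levels used are null for the radius of the tail process.\<close>

lemma isCont_threshold:
  fixes a :: "'b::t2_space \<Rightarrow> real" and b :: "'b \<Rightarrow> 'c::{topological_space, zero}"
  assumes a: "isCont a v" "a v \<noteq> y" and b: "y < a v \<Longrightarrow> isCont b v"
  shows "isCont (\<lambda>w. if y < a w then b w else 0) v"
proof -
  have lim: "(a \<longlongrightarrow> a v) (nhds v)"
    using a(1) by (simp add: continuous_at tendsto_at_iff_tendsto_nhds)
  show ?thesis
  proof (cases "y < a v")
    case True
    then have "\<forall>\<^sub>F w in nhds v. y < a w"
      using lim by (rule order_tendstoD(1)[rotated])
    then have "\<forall>\<^sub>F w in nhds v. (if y < a w then b w else 0) = b w"
      by eventually_elim simp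
    from isCont_cong[OF this] b[OF True] show ?thesis
      by simp
  next
    case False
    then have "a v < y"
      using a(2) by simp
    then have "\<forall>\<^sub>F w in nhds v. a w < y"
      using lim by (rule order_tendstoD(2)[rotated])
    then have "\<forall>\<^sub>F w in nhds v. (if y < a w then b w else 0) = 0"
      by eventually_elim simp
    from isCont_cong[OF this] show ?thesis
      by simp
  qed
qed

lemma measurable_window [measurable]:
  fixes X :: "int \<Rightarrow> 'w \<Rightarrow> 'a::euclidean_space"
  assumes [measurable]: "\<And>t. X t \<in> borel_measurable M"
  shows "window I X \<in> borel_measurable M"
  by (rule measurable_coordinatewise_then_product) (auto simp: window_def)

lemma (in prob_space) integral_uniform_measure:
  fixes g :: "'a \<Rightarrow> complex"
  assumes A [measurable]: "A \<in> events" and pos: "prob A > 0" and g [measurable]: "g \<in> borel_measurable M"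
  shows "integral\<^sup>L (uniform_measure M A) g = (\<integral>x. indicator A x *\<^sub>R g x \<partial>M) / complex_of_real (prob A)"
proof -
  have "uniform_measure M A = density M (\<lambda>x. ennreal (indicator A x / prob A))"
    unfolding uniform_measure_def
    using pos by (intro density_cong) (auto simp: emeasure_eq_measure indicator_def divide_ennreal
        simp flip: ennreal_1)
  then have "integral\<^sup>L (uniform_measure M A) g = (\<integral>x. (indicator A x / prob A) *\<^sub>R g x \<partial>M)"
    by (simp add: integral_density)
  also have "\<dots> = (\<integral>x. (indicator A x *\<^sub>R g x) / complex_of_real (prob A) \<partial>M)"
    by (intro Bochner_Integration.integral_cong) (auto simp: scaleR_conv_of_real)
  finally show ?thesis
    by simp
qed

section \<open>Conditional limits and the Pareto law of the radius\<close>

locale tail_process_space = prob_space M for M :: "'w measure" +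
  fixes X :: "int \<Rightarrow> 'w \<Rightarrow> 'a::euclidean_space" and \<alpha> :: real
    and N :: "'v measure" and Y :: "int \<Rightarrow> 'v \<Rightarrow> 'a"
  assumes X_meas [measurable]: "\<And>t. X t \<in> borel_measurable M"
    and \<alpha>_pos: "\<alpha> > 0"
    and tail: "tail_process M \<alpha> X N Y"
begin

lemma Y_meas [measurable]: "Y t \<in> borel_measurable N"
  using tail by (simp add: tail_process_def)

sublocale N: prob_space N
  using tail by (simp add: tail_process_def)

definition tail_prob :: "real \<Rightarrow> real" where
  "tail_prob x = prob {\<omega> \<in> space M. norm (X 0 \<omega>) > x}"

lemma tail_prob_nonneg [simp]: "tail_prob x \<ge> 0"
  by (simp add: tail_prob_def)

lemma tail_process_weakly:
  "converges_weakly (\<lambda>x. distr (uniform_measure M {\<omega> \<in> space M. norm (X 0 \<omega>) > x}) borel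
     (window {- int k..int k} (\<lambda>t \<omega>. X t \<omega> /\<^sub>R x)))
   (distr N borel (window {- int k..int k} Y)) at_top"
  using tail by (simp add: tail_process_def)

text \<open>Test weak convergence on the constant 1: conditioning on a null event yields the zero
  measure, whereas the limit has mass 1.\<close>

lemma tail_prob_pos: "\<forall>\<^sub>F x in at_top. tail_prob x > 0"
proof -
  let ?A = "\<lambda>x. {\<omega> \<in> space M. norm (X 0 \<omega>) > x}"
  let ?\<mu> = "\<lambda>x. distr (uniform_measure M (?A x)) borel (window {- int 0..int 0} (\<lambda>t \<omega>. X t \<omega> /\<^sub>R x))"
  have "continuous_on UNIV (\<lambda>v::int \<Rightarrow> 'a. 1::real)" "bounded (range (\<lambda>v::int \<Rightarrow> 'a. 1::real))"
    by auto
  with tail_process_weakly[of 0]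
  have "((\<lambda>x. integral\<^sup>L (?\<mu> x) (\<lambda>_. 1)) \<longlongrightarrow>
      integral\<^sup>L (distr N borel (window {- int 0..int 0} Y)) (\<lambda>_. 1::real)) at_top"
    unfolding converges_weakly_def by blast
  also have "integral\<^sup>L (distr N borel (window {- int 0..int 0} Y)) (\<lambda>_. 1::real) = 1"
    by (subst integral_distr) (simp_all add: N.prob_space)
  finally have "\<forall>\<^sub>F x in at_top. integral\<^sup>L (?\<mu> x) (\<lambda>_. 1::real) > 0"
    by (rule order_tendstoD) simp
  then show ?thesis
  proof eventually_elim
    case (elim x)
    show ?case
    proof (rule ccontr)
      assume "\<not> 0 < tail_prob x"
      then have "prob (?A x) = 0"
        using tail_prob_nonneg[of x] unfolding tail_prob_def by linarith
      then have "emeasure M (?A x) = 0"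
        by (simp add: emeasure_eq_measure)
      moreover have "emeasure M (?A x \<inter> space M) = emeasure M (?A x)"
        by (rule arg_cong[where f="emeasure M"]) auto
      ultimately have "emeasure (uniform_measure M (?A x)) (space M) = 0"
        by (subst emeasure_uniform_measure) auto
      then have "integral\<^sup>L (?\<mu> x) (\<lambda>_. 1::real) = 0"
        by (subst integral_distr) (auto simp: measure_def)
      with elim show False
        by linarith
    qed
  qed
qed

text \<open>The form in which the tail process is used. Writing the conditional mean as a quotient
  by \<open>tail_prob x\<close> allows the level \<open>x\<close> to be changed later by multiplying
  with a ratio of tail probabilities.\<close>

lemma tail_tendsto:
  fixes G :: "(int \<Rightarrow> 'a) \<Rightarrow> complex"
  assumes G [measurable]: "G \<in> borel_measurable borel" and bd: "\<And>v. norm (G v) \<le> C"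
    and cont: "AE \<omega> in N. isCont G (window {- int k..int k} Y \<omega>)"
  shows "((\<lambda>x. (\<integral>\<omega>. indicator {\<omega> \<in> space M. norm (X 0 \<omega>) > x} \<omega> *\<^sub>R
        G (window {- int k..int k} (\<lambda>t \<omega>. X t \<omega> /\<^sub>R x) \<omega>) \<partial>M) / complex_of_real (tail_prob x))
     \<longlongrightarrow> (\<integral>\<omega>. G (window {- int k..int k} Y \<omega>) \<partial>N)) at_top"
proof -
  let ?A = "\<lambda>x. {\<omega> \<in> space M. norm (X 0 \<omega>) > x}"
  let ?W = "\<lambda>x. window {- int k..int k} (\<lambda>t \<omega>. X t \<omega> /\<^sub>R x)"
  let ?\<mu> = "\<lambda>x. distr (uniform_measure M (?A x)) borel (?W x)"
  let ?\<nu> = "distr N borel (window {- int k..int k} Y)"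
  have W [measurable]: "?W x \<in> borel_measurable M" for x
    by measurable
  have W': "?W x \<in> borel_measurable (uniform_measure M (?A x))" for x
    by measurable
  have "((\<lambda>x. integral\<^sup>L (?\<mu> x) G) \<longlongrightarrow> integral\<^sup>L ?\<nu> G) at_top"
  proof (rule converges_weakly_tendsto[OF tail_process_weakly _ _ _ _ G bd])
    show "\<forall>\<^sub>F x in at_top. finite_measure (?\<mu> x)"
      using tail_prob_pos
    proof eventually_elim
      case (elim x)
      then have "emeasure M (?A x) \<noteq> 0"
        by (auto simp: tail_prob_def emeasure_eq_measure)
      then have "prob_space (uniform_measure M (?A x))"
        by (intro prob_space_uniform_measure) auto
      then show ?case
        by (intro prob_space.finite_measure prob_space.prob_space_distr W')
    qed
    show "finite_measure ?\<nu>"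
      by (intro prob_space.finite_measure N.prob_space_distr) measurable
    show "AE x in ?\<nu>. isCont G x"
      using cont by (subst AE_distr_iff) auto
  qed auto
  moreover have "\<forall>\<^sub>F x in at_top. integral\<^sup>L (?\<mu> x) G =
      (\<integral>\<omega>. indicator (?A x) \<omega> *\<^sub>R G (?W x \<omega>) \<partial>M) / complex_of_real (tail_prob x)"
    using tail_prob_pos
  proof eventually_elim
    case (elim x)
    have "integral\<^sup>L (?\<mu> x) G = (\<integral>\<omega>. G (?W x \<omega>) \<partial>uniform_measure M (?A x))"
      by (rule integral_distr[OF W' G])
    also have "\<dots> = (\<integral>\<omega>. indicator (?A x) \<omega> *\<^sub>R G (?W x \<omega>) \<partial>M) / complex_of_real (tail_prob x)"
      unfolding tail_prob_def
      by (rule integral_uniform_measure) (use elim in \<open>auto simp: tail_prob_def\<close>)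
    finally show ?case .
  qed
  moreover have "integral\<^sup>L ?\<nu> G = (\<integral>\<omega>. G (window {- int k..int k} Y \<omega>) \<partial>N)"
    by (rule integral_distr) auto
  ultimately show ?thesis
    using Lim_transform_eventually by fastforce
qed

text \<open>\<open>tail_process\<close> prescribes the survival function only beyond 1. Letting
  \<open>z\<close> decrease to 1 in \<open>z powr (- \<alpha>)\<close> forces the value 1 at and
  below 1, whence the maximum in the formula.\<close>

lemma prob_norm_Y0: "N.prob {\<omega> \<in> space N. norm (Y 0 \<omega>) > y} = (1 / max 1 y) powr \<alpha>"
proof -
  have gt: "N.prob {\<omega> \<in> space N. norm (Y 0 \<omega>) > y} = y powr (- \<alpha>)" if "y > 1" for y
    using tail that by (simp add: tail_process_def)
  show ?thesis
  proof (cases "y > 1")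
    case True
    then show ?thesis
      by (simp add: gt powr_divide powr_minus_divide)
  next
    case False
    have "((\<lambda>z::real. z powr (- \<alpha>)) \<longlongrightarrow> 1 powr (- \<alpha>)) (at_right 1)"
      by (intro tendsto_intros) auto
    moreover have "\<forall>\<^sub>F z in at_right 1. z powr (- \<alpha>) \<le> N.prob {\<omega> \<in> space N. norm (Y 0 \<omega>) > y}"
    proof -
      have "z powr (- \<alpha>) \<le> N.prob {\<omega> \<in> space N. norm (Y 0 \<omega>) > y}" if "z > 1" for z
        using that False unfolding gt[OF that, symmetric]
        by (intro N.finite_measure_mono) auto
      then show ?thesis
        by (auto simp: eventually_at_right_less intro: eventually_at_rightI[of 1 2])
    qed
    ultimately have "1 powr (- \<alpha>) \<le> N.prob {\<omega> \<in> space N. norm (Y 0 \<omega>) > y}"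
      by (intro tendsto_upperbound) auto
    then have "N.prob {\<omega> \<in> space N. norm (Y 0 \<omega>) > y} = 1"
      using N.prob_le_1 by (simp add: antisym)
    then show ?thesis
      using False by (simp add: max_def)
  qed
qed

lemma distr_norm_Y0: "distr N borel (\<lambda>\<omega>. norm (Y 0 \<omega>)) = pareto 1 \<alpha>"
proof (rule measure_eqI_lessThan)
  fix x
  have *: "(\<lambda>\<omega>. norm (Y 0 \<omega>)) -` {x<..} \<inter> space N = {\<omega> \<in> space N. norm (Y 0 \<omega>) > x}"
    by auto
  show "emeasure (distr N borel (\<lambda>\<omega>. norm (Y 0 \<omega>))) {x<..} < \<infinity>"
    by (subst emeasure_distr) (auto simp: N.emeasure_eq_measure)
  show "emeasure (distr N borel (\<lambda>\<omega>. norm (Y 0 \<omega>))) {x<..} = emeasure (pareto 1 \<alpha>) {x<..}"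
    using \<alpha>_pos
    by (subst emeasure_distr) (auto simp: * N.emeasure_eq_measure prob_norm_Y0 emeasure_pareto_Ioi)
qed auto

lemma AE_norm_Y0_gt_1: "AE \<omega> in N. norm (Y 0 \<omega>) > 1"
proof -
  have "AE y in distr N borel (\<lambda>\<omega>. norm (Y 0 \<omega>)). y > 1"
    unfolding distr_norm_Y0 using \<alpha>_pos by (subst AE_pareto_iff) auto
  then show ?thesis
    by (subst (asm) AE_distr_iff) auto
qed

text \<open>The Pareto law has no atoms; this is what makes radial cutoffs almost surely continuous
  at \<open>Y\<close>.\<close>

lemma AE_norm_Y0_neq: "AE \<omega> in N. norm (Y 0 \<omega>) \<noteq> y"
proof -
  have "AE z in distr N borel (\<lambda>\<omega>. norm (Y 0 \<omega>)). z \<noteq> y"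
    unfolding distr_norm_Y0 using \<alpha>_pos AE_lborel_singleton[of y] by (subst AE_pareto_iff) auto
  then show ?thesis
    by (subst (asm) AE_distr_iff) auto
qed

end

lemma borel_measurable_coordinate [measurable]:
  "(\<lambda>v :: 'i::countable \<Rightarrow> 'a::euclidean_space. v i) \<in> borel_measurable borel"
  by (intro borel_measurable_continuous_onI continuous_on_product_coordinates)

lemma isCont_norm_coordinate:
  fixes v :: "'i::countable \<Rightarrow> 'a::real_normed_vector"
  shows "isCont (\<lambda>v. norm (v i)) v"
proof -
  have "continuous_on UNIV (\<lambda>v :: 'i \<Rightarrow> 'a. norm (v i))"
    by (intro continuous_on_norm continuous_on_product_coordinates)
  then show ?thesis
    by (simp add: continuous_on_eq_continuous_at)
qed

lemma isCont_polar:
  fixes v :: "int \<Rightarrow> 'a::euclidean_space"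
  assumes "v 0 \<noteq> 0"
  shows "isCont (\<lambda>v i. v i /\<^sub>R norm (v 0)) v"
proof -
  let ?U = "{v :: int \<Rightarrow> 'a. v 0 \<noteq> 0}"
  have "open ?U"
    by (intro open_Collect_neq continuous_on_product_coordinates) auto
  moreover have "continuous_on ?U (\<lambda>v i. v i /\<^sub>R norm (v 0))"
  proof (rule continuous_on_coordinatewise_then_product)
    fix i
    have "continuous_on ?U (\<lambda>v. v j)" for j
      using continuous_on_product_coordinates by (rule continuous_on_subset) auto
    then show "continuous_on ?U (\<lambda>v. v i /\<^sub>R norm (v 0))"
      by (intro continuous_intros) auto
  qed
  ultimately show ?thesis
    using assms by (auto simp: continuous_on_eq_continuous_at)
qed

context tail_process_space
begin

text \<open>Regular variation of \<open>norm (X 0)\<close>. For \<open>y > 1\<close> the event at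
  level \<open>y * x\<close> lies inside the conditioning event, so the cutoff of the radius at
  \<open>y\<close> is an admissible functional of the tail process. For \<open>y < 1\<close> this
  inclusion fails; the case \<open>1 / y\<close> at level \<open>y * x\<close> is inverted
  instead.\<close>

lemma tail_prob_ratio:
  assumes "y > 0"
  shows "((\<lambda>x. tail_prob (y * x) / tail_prob x) \<longlongrightarrow> y powr (- \<alpha>)) at_top"
proof -
  have gt: "((\<lambda>x. tail_prob (y * x) / tail_prob x) \<longlongrightarrow> y powr (- \<alpha>)) at_top" if y: "y > 1" for y
  proof -
    let ?G = "\<lambda>v :: int \<Rightarrow> 'a. if y < norm (v 0) then 1 else 0 :: complex"
    let ?I = "{- int 0..int 0}"
    have "((\<lambda>x. (\<integral>\<omega>. indicator {\<omega> \<in> space M. norm (X 0 \<omega>) > x} \<omega> *\<^sub>R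
            ?G (window ?I (\<lambda>t \<omega>. X t \<omega> /\<^sub>R x) \<omega>) \<partial>M) / complex_of_real (tail_prob x))
         \<longlongrightarrow> (\<integral>\<omega>. ?G (window ?I Y \<omega>) \<partial>N)) at_top"
    proof (rule tail_tendsto[where C=1])
      show "AE \<omega> in N. isCont ?G (window ?I Y \<omega>)"
        using AE_norm_Y0_neq[of y]
      proof eventually_elim
        case (elim \<omega>)
        have "isCont (\<lambda>v :: int \<Rightarrow> 'a. norm (v 0)) (window ?I Y \<omega>)"
          by (rule isCont_norm_coordinate)
        with elim show ?case
          by (intro isCont_threshold) (auto simp: window_def)
      qed
    qed auto
    moreover have "\<forall>\<^sub>F x in at_top. (\<integral>\<omega>. indicator {\<omega> \<in> space M. norm (X 0 \<omega>) > x} \<omega> *\<^sub>R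
          ?G (window ?I (\<lambda>t \<omega>. X t \<omega> /\<^sub>R x) \<omega>) \<partial>M) / complex_of_real (tail_prob x)
        = complex_of_real (tail_prob (y * x) / tail_prob x)"
      using eventually_gt_at_top[of 0]
    proof eventually_elim
      case (elim x)
      have le: "x < y * x"
        using elim y by simp
      have iff: "y < norm (window ?I (\<lambda>t \<omega>. X t \<omega> /\<^sub>R x) \<omega> 0) \<longleftrightarrow> y * x < norm (X 0 \<omega>)" for \<omega>
        using elim by (simp add: window_def field_simps)
      have "(\<integral>\<omega>. indicator {\<omega> \<in> space M. norm (X 0 \<omega>) > x} \<omega> *\<^sub>R
          ?G (window ?I (\<lambda>t \<omega>. X t \<omega> /\<^sub>R x) \<omega>) \<partial>M)
        = (\<integral>\<omega>. complex_of_real (indicator {\<omega> \<in> space M. norm (X 0 \<omega>) > y * x} \<omega>) \<partial>M)"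
        unfolding iff by (intro Bochner_Integration.integral_cong)
          (auto simp: indicator_def intro: less_trans[OF le])
      also have "\<dots> = complex_of_real (tail_prob (y * x))"
        by (subst integral_complex_of_real) (simp add: tail_prob_def)
      finally show ?case
        by simp
    qed
    moreover have "(\<integral>\<omega>. ?G (window ?I Y \<omega>) \<partial>N) = complex_of_real (y powr (- \<alpha>))"
    proof -
      have "(\<integral>\<omega>. ?G (window ?I Y \<omega>) \<partial>N)
          = (\<integral>\<omega>. complex_of_real (indicator {\<omega> \<in> space N. norm (Y 0 \<omega>) > y} \<omega>) \<partial>N)"
        by (intro Bochner_Integration.integral_cong) (auto simp: window_def indicator_def)
      also have "\<dots> = complex_of_real (N.prob {\<omega> \<in> space N. norm (Y 0 \<omega>) > y})"
        by (subst integral_complex_of_real) simp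
      finally show ?thesis
        using y by (simp add: prob_norm_Y0 powr_divide powr_minus_divide)
    qed
    ultimately have "((\<lambda>x. complex_of_real (tail_prob (y * x) / tail_prob x)) \<longlongrightarrow> complex_of_real (y powr (- \<alpha>))) at_top"
      using Lim_transform_eventually by fastforce
    then show ?thesis
      by (simp only: tendsto_of_real_iff)
  qed
  consider "y > 1" | "y = 1" | "y < 1"
    by linarith
  then show ?thesis
  proof cases
    case 1
    then show ?thesis by (rule gt)
  next
    case 2
    have "\<forall>\<^sub>F x in at_top. 1 = tail_prob (y * x) / tail_prob x"
      using tail_prob_pos by eventually_elim (simp add: 2)
    then show ?thesis
      using 2 by (intro Lim_transform_eventually[OF tendsto_const]) auto
  next
    case 3
    have lim: "filterlim (\<lambda>x. y * x) at_top at_top"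
      using assms by (intro filterlim_tendsto_pos_mult_at_top[OF tendsto_const] filterlim_ident)
    have "((\<lambda>x. tail_prob (1 / y * (y * x)) / tail_prob (y * x)) \<longlongrightarrow> (1 / y) powr (- \<alpha>)) at_top"
      using filterlim_compose[OF gt[of "1 / y"] lim] assms 3 by simp
    then have "((\<lambda>x. inverse (tail_prob (1 / y * (y * x)) / tail_prob (y * x))) \<longlongrightarrow> inverse ((1 / y) powr (- \<alpha>))) at_top"
      using assms by (intro tendsto_inverse) auto
    then show ?thesis
      using assms by (simp add: powr_divide)
  qed
qed

section \<open>Independence of the radius and the spectral tail process\<close>

definition \<Theta> :: "int \<Rightarrow> 'v \<Rightarrow> 'a" where
  "\<Theta> t \<omega> = Y t \<omega> /\<^sub>R norm (Y 0 \<omega>)"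

lemma \<Theta>_meas [measurable]: "\<Theta> t \<in> borel_measurable N"
  unfolding \<Theta>_def by measurable

text \<open>Dividing by \<open>norm (X 0)\<close> removes the scale \<open>x\<close>, so a cutoff of
  the radius at \<open>y\<close> becomes the event at level \<open>y * x\<close> and leaves the
  argument of \<open>F\<close> unchanged. Cutoff and normalisation are continuous at
  \<open>Y\<close> because its radius almost surely exceeds 1 and differs from
  \<open>y\<close>.\<close>

lemma tail_tendsto_polar:
  fixes F :: "(int \<Rightarrow> 'a) \<Rightarrow> real"
  assumes F: "continuous_on UNIV F" and bd: "\<And>v. \<bar>F v\<bar> \<le> C" and y: "y \<ge> 1"
  shows "((\<lambda>x. (\<integral>\<omega>. indicator {\<omega> \<in> space M. norm (X 0 \<omega>) > y * x} \<omega> *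
        F (window {- int k..int k} (\<lambda>t \<omega>. X t \<omega> /\<^sub>R norm (X 0 \<omega>)) \<omega>) \<partial>M) / tail_prob x)
     \<longlongrightarrow> (\<integral>\<omega>. indicator {\<omega> \<in> space N. norm (Y 0 \<omega>) > y} \<omega> * F (window {- int k..int k} \<Theta> \<omega>) \<partial>N)) at_top"
proof -
  let ?I = "{- int k..int k}"
  let ?P = "\<lambda>(v :: int \<Rightarrow> 'a) i. v i /\<^sub>R norm (v 0)"
  let ?G = "\<lambda>v. if y < norm (v 0) then complex_of_real (F (?P v)) else 0"
  have [measurable]: "F \<in> borel_measurable borel"
    using F by (rule borel_measurable_continuous_onI)
  have [measurable]: "?P \<in> borel_measurable borel"
    by (rule measurable_coordinatewise_then_product) measurable
  have "((\<lambda>x. (\<integral>\<omega>. indicator {\<omega> \<in> space M. norm (X 0 \<omega>) > x} \<omega> *\<^sub>R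
        ?G (window ?I (\<lambda>t \<omega>. X t \<omega> /\<^sub>R x) \<omega>) \<partial>M) / complex_of_real (tail_prob x))
     \<longlongrightarrow> (\<integral>\<omega>. ?G (window ?I Y \<omega>) \<partial>N)) at_top"
  proof (rule tail_tendsto[where C="max C 0"])
    show "norm (?G v) \<le> max C 0" for v
      using bd[of "?P v"] by auto
    show "AE \<omega> in N. isCont ?G (window ?I Y \<omega>)"
      using AE_norm_Y0_neq[of y] AE_norm_Y0_gt_1
    proof eventually_elim
      case (elim \<omega>)
      let ?v = "window ?I Y \<omega>"
      have v0: "?v 0 = Y 0 \<omega>"
        by (simp add: window_def)
      have cont: "isCont (\<lambda>v :: int \<Rightarrow> 'a. norm (v 0)) ?v"
        by (rule isCont_norm_coordinate)
      have "isCont ?P ?v"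
        using elim by (intro isCont_polar) (auto simp: v0)
      moreover have "isCont F (?P ?v)"
        using F by (simp add: continuous_on_eq_continuous_at)
      ultimately have "isCont (\<lambda>v. F (?P v)) ?v"
        by (rule isCont_o2[of _ ?P F])
      then have "isCont (\<lambda>v. complex_of_real (F (?P v))) ?v"
        by (intro continuous_intros)
      with elim cont show ?case
        by (intro isCont_threshold) (auto simp: v0)
    qed
  qed measurable
  moreover have "\<forall>\<^sub>F x in at_top. (\<integral>\<omega>. indicator {\<omega> \<in> space M. norm (X 0 \<omega>) > x} \<omega> *\<^sub>R
        ?G (window ?I (\<lambda>t \<omega>. X t \<omega> /\<^sub>R x) \<omega>) \<partial>M) / complex_of_real (tail_prob x)
      = complex_of_real ((\<integral>\<omega>. indicator {\<omega> \<in> space M. norm (X 0 \<omega>) > y * x} \<omega> *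
        F (window ?I (\<lambda>t \<omega>. X t \<omega> /\<^sub>R norm (X 0 \<omega>)) \<omega>) \<partial>M) / tail_prob x)"
    using eventually_gt_at_top[of 0]
  proof eventually_elim
    case (elim x)
    have le: "x \<le> y * x"
      using elim y by simp
    have "(\<integral>\<omega>. indicator {\<omega> \<in> space M. norm (X 0 \<omega>) > x} \<omega> *\<^sub>R
        ?G (window ?I (\<lambda>t \<omega>. X t \<omega> /\<^sub>R x) \<omega>) \<partial>M)
      = (\<integral>\<omega>. complex_of_real (indicator {\<omega> \<in> space M. norm (X 0 \<omega>) > y * x} \<omega> *
        F (window ?I (\<lambda>t \<omega>. X t \<omega> /\<^sub>R norm (X 0 \<omega>)) \<omega>)) \<partial>M)"
    proof (rule Bochner_Integration.integral_cong)
      fix \<omega> assume "\<omega> \<in> space M"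
      have "?P (window ?I (\<lambda>t \<omega>. X t \<omega> /\<^sub>R x) \<omega>) = window ?I (\<lambda>t \<omega>. X t \<omega> /\<^sub>R norm (X 0 \<omega>)) \<omega>"
        using elim by (auto simp: window_def fun_eq_iff field_simps)
      moreover have "y < norm (window ?I (\<lambda>t \<omega>. X t \<omega> /\<^sub>R x) \<omega> 0) \<longleftrightarrow> y * x < norm (X 0 \<omega>)"
        using elim by (simp add: window_def field_simps)
      ultimately show "indicator {\<omega> \<in> space M. norm (X 0 \<omega>) > x} \<omega> *\<^sub>R
          ?G (window ?I (\<lambda>t \<omega>. X t \<omega> /\<^sub>R x) \<omega>) =
        complex_of_real (indicator {\<omega> \<in> space M. norm (X 0 \<omega>) > y * x} \<omega> *
          F (window ?I (\<lambda>t \<omega>. X t \<omega> /\<^sub>R norm (X 0 \<omega>)) \<omega>))"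
        using le \<open>\<omega> \<in> space M\<close> by (auto simp: indicator_def)
    qed simp
    then show ?case
      by (simp only: integral_complex_of_real of_real_divide)
  qed
  moreover have "(\<integral>\<omega>. ?G (window ?I Y \<omega>) \<partial>N)
      = complex_of_real (\<integral>\<omega>. indicator {\<omega> \<in> space N. norm (Y 0 \<omega>) > y} \<omega> * F (window ?I \<Theta> \<omega>) \<partial>N)"
  proof -
    have "(\<integral>\<omega>. ?G (window ?I Y \<omega>) \<partial>N)
        = (\<integral>\<omega>. complex_of_real (indicator {\<omega> \<in> space N. norm (Y 0 \<omega>) > y} \<omega> * F (window ?I \<Theta> \<omega>)) \<partial>N)"
    proof (rule Bochner_Integration.integral_cong)
      fix \<omega> assume "\<omega> \<in> space N"
      have "?P (window ?I Y \<omega>) = window ?I \<Theta> \<omega>"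
        by (auto simp: window_def fun_eq_iff \<Theta>_def)
      moreover have "window ?I Y \<omega> 0 = Y 0 \<omega>"
        by (simp add: window_def)
      ultimately show "?G (window ?I Y \<omega>) =
        complex_of_real (indicator {\<omega> \<in> space N. norm (Y 0 \<omega>) > y} \<omega> * F (window ?I \<Theta> \<omega>))"
        using \<open>\<omega> \<in> space N\<close> by (auto simp: indicator_def)
    qed simp
    then show ?thesis
      by (simp only: integral_complex_of_real)
  qed
  ultimately have "((\<lambda>x. complex_of_real ((\<integral>\<omega>. indicator {\<omega> \<in> space M. norm (X 0 \<omega>) > y * x} \<omega> *
        F (window ?I (\<lambda>t \<omega>. X t \<omega> /\<^sub>R norm (X 0 \<omega>)) \<omega>) \<partial>M) / tail_prob x)) \<longlongrightarrow>
      complex_of_real (\<integral>\<omega>. indicator {\<omega> \<in> space N. norm (Y 0 \<omega>) > y} \<omega> * F (window ?I \<Theta> \<omega>) \<partial>N)) at_top"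
    using Lim_transform_eventually by fastforce
  then show ?thesis
    by (simp only: tendsto_of_real_iff)
qed

text \<open>The same limit is computed twice: with cutoff \<open>y\<close> at level
  \<open>x\<close>, and with cutoff 1 at level \<open>y * x\<close> multiplied by the tail ratio,
  which tends to \<open>y powr (- \<alpha>)\<close>. Equating the two gives the product
  formula.\<close>

lemma spectral_integral_independent:
  fixes F :: "(int \<Rightarrow> 'a) \<Rightarrow> real"
  assumes F: "continuous_on UNIV F" and bd: "\<And>v. \<bar>F v\<bar> \<le> C" and y: "y \<ge> 1"
  shows "(\<integral>\<omega>. indicator {\<omega> \<in> space N. norm (Y 0 \<omega>) > y} \<omega> * F (window {- int k..int k} \<Theta> \<omega>) \<partial>N)
    = y powr (- \<alpha>) * (\<integral>\<omega>. F (window {- int k..int k} \<Theta> \<omega>) \<partial>N)"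
proof -
  let ?I = "{- int k..int k}"
  let ?T = "\<lambda>x. \<integral>\<omega>. indicator {\<omega> \<in> space M. norm (X 0 \<omega>) > x} \<omega> *
        F (window ?I (\<lambda>t \<omega>. X t \<omega> /\<^sub>R norm (X 0 \<omega>)) \<omega>) \<partial>M"
  have [measurable]: "F \<in> borel_measurable borel"
    using F by (rule borel_measurable_continuous_onI)
  have "(\<integral>\<omega>. indicator {\<omega> \<in> space N. norm (Y 0 \<omega>) > 1} \<omega> * F (window ?I \<Theta> \<omega>) \<partial>N)
      = (\<integral>\<omega>. F (window ?I \<Theta> \<omega>) \<partial>N)"
  proof (rule integral_cong_AE)
    show "AE \<omega> in N. indicator {\<omega> \<in> space N. norm (Y 0 \<omega>) > 1} \<omega> * F (window ?I \<Theta> \<omega>) = F (window ?I \<Theta> \<omega>)"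
      using AE_norm_Y0_gt_1 AE_space by eventually_elim simp
  qed measurable
  then have "((\<lambda>x. ?T x / tail_prob x) \<longlongrightarrow> (\<integral>\<omega>. F (window ?I \<Theta> \<omega>) \<partial>N)) at_top"
    using tail_tendsto_polar[OF F bd order_refl, of k] by simp
  moreover have "filterlim (\<lambda>x. y * x) at_top at_top"
    using y by (intro filterlim_tendsto_pos_mult_at_top[OF tendsto_const] filterlim_ident) auto
  ultimately have "((\<lambda>x. ?T (y * x) / tail_prob (y * x)) \<longlongrightarrow> (\<integral>\<omega>. F (window ?I \<Theta> \<omega>) \<partial>N)) at_top"
    and pos: "\<forall>\<^sub>F x in at_top. tail_prob (y * x) > 0"
    by (rule filterlim_compose) (rule eventually_compose_filterlim[OF tail_prob_pos], fact)
  then have "((\<lambda>x. tail_prob (y * x) / tail_prob x * (?T (y * x) / tail_prob (y * x)))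
      \<longlongrightarrow> y powr (- \<alpha>) * (\<integral>\<omega>. F (window ?I \<Theta> \<omega>) \<partial>N)) at_top"
    using y by (intro tendsto_mult tail_prob_ratio) auto
  moreover have "\<forall>\<^sub>F x in at_top. tail_prob (y * x) / tail_prob x * (?T (y * x) / tail_prob (y * x)) = ?T (y * x) / tail_prob x"
    using pos by eventually_elim simp
  ultimately have "((\<lambda>x. ?T (y * x) / tail_prob x) \<longlongrightarrow> y powr (- \<alpha>) * (\<integral>\<omega>. F (window ?I \<Theta> \<omega>) \<partial>N)) at_top"
    by (rule Lim_transform_eventually)
  with tail_tendsto_polar[OF F bd y, of k] show ?thesis
    by (intro tendsto_unique[OF trivial_limit_at_top_linorder])
qed

text \<open>From continuous \<open>F\<close> to Borel \<open>B\<close>: the law of the spectral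
  window weighted by the indicator of \<open>norm (Y 0) > y\<close> and the one weighted by the
  constant \<open>y powr (- \<alpha>)\<close> are finite measures with equal integrals of bounded
  continuous functions.\<close>

lemma spectral_emeasure_independent:
  assumes B [measurable]: "B \<in> sets borel"
  shows "emeasure N {\<omega> \<in> space N. norm (Y 0 \<omega>) > y \<and> window {- int k..int k} \<Theta> \<omega> \<in> B}
    = ennreal ((1 / max 1 y) powr \<alpha>) * emeasure N {\<omega> \<in> space N. window {- int k..int k} \<Theta> \<omega> \<in> B}"
proof -
  let ?W = "window {- int k..int k} \<Theta>"
  have ge: "emeasure N {\<omega> \<in> space N. norm (Y 0 \<omega>) > y \<and> ?W \<omega> \<in> B}
    = ennreal (y powr (- \<alpha>)) * emeasure N {\<omega> \<in> space N. ?W \<omega> \<in> B}" if y: "y \<ge> 1" for y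
  proof -
    let ?f1 = "\<lambda>\<omega>. indicator {\<omega> \<in> space N. norm (Y 0 \<omega>) > y} \<omega> :: real" and ?f2 = "\<lambda>_. y powr (- \<alpha>)"
    let ?\<mu> = "\<lambda>f. distr (density N (\<lambda>\<omega>. ennreal (f \<omega>))) borel ?W"
    have em: "emeasure (?\<mu> f) A = (\<integral>\<^sup>+\<omega>. ennreal (f \<omega>) * indicator {\<omega> \<in> space N. ?W \<omega> \<in> A} \<omega> \<partial>N)"
      if [measurable]: "f \<in> borel_measurable N" "A \<in> sets borel" for f A
      by (subst emeasure_distr; (subst emeasure_density)?)
         (auto intro!: nn_integral_cong simp: indicator_def)
    have int: "integral\<^sup>L (?\<mu> f) F = (\<integral>\<omega>. f \<omega> * F (?W \<omega>) \<partial>N)"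
      if [measurable]: "f \<in> borel_measurable N" "F \<in> borel_measurable borel" and "\<And>\<omega>. f \<omega> \<ge> 0"
      for f and F :: "(int \<Rightarrow> 'a) \<Rightarrow> real"
      by (subst integral_distr; (subst integral_density)?) (use that in auto)
    have fin: "finite_measure (?\<mu> f)" if [measurable]: "f \<in> borel_measurable N" and "\<And>\<omega>. f \<omega> \<le> 1" for f
    proof
      have "emeasure (?\<mu> f) (space (?\<mu> f)) = (\<integral>\<^sup>+\<omega>. ennreal (f \<omega>) * indicator {\<omega> \<in> space N. ?W \<omega> \<in> UNIV} \<omega> \<partial>N)"
        using em[of f UNIV] by simp
      also have "\<dots> \<le> (\<integral>\<^sup>+\<omega>. 1 \<partial>N)"
        using that by (intro nn_integral_mono) (auto simp: indicator_def)
      also have "\<dots> < \<infinity>"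
        by (simp add: N.emeasure_space_1)
      finally show "emeasure (?\<mu> f) (space (?\<mu> f)) \<noteq> \<infinity>"
        by simp
    qed
    have "?\<mu> ?f1 = ?\<mu> ?f2"
    proof (rule measure_eqI_bounded_continuous)
      show "finite_measure (?\<mu> ?f1)"
        by (rule fin) (auto simp: indicator_def)
      have "1 \<le> y powr \<alpha>"
        using y \<alpha>_pos by (simp add: ge_one_powr_ge_zero)
      then show "finite_measure (?\<mu> ?f2)"
        by (intro fin) (auto simp: powr_minus inverse_le_1_iff)
      fix g :: "(int \<Rightarrow> 'a) \<Rightarrow> real" assume g: "continuous_on UNIV g" "bounded (range g)"
      then obtain C where C: "\<And>v. \<bar>g v\<bar> \<le> C"
        by (auto simp: bounded_iff)
      have [measurable]: "g \<in> borel_measurable borel"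
        using g(1) by (rule borel_measurable_continuous_onI)
      show "integral\<^sup>L (?\<mu> ?f1) g = integral\<^sup>L (?\<mu> ?f2) g"
        using spectral_integral_independent[OF g(1) C y, of k] by (simp add: int)
    qed auto
    then have "emeasure (?\<mu> ?f1) B = emeasure (?\<mu> ?f2) B"
      by simp
    then have "(\<integral>\<^sup>+\<omega>. ennreal (?f1 \<omega>) * indicator {\<omega> \<in> space N. ?W \<omega> \<in> B} \<omega> \<partial>N)
        = (\<integral>\<^sup>+\<omega>. ennreal (y powr (- \<alpha>)) * indicator {\<omega> \<in> space N. ?W \<omega> \<in> B} \<omega> \<partial>N)"
      by (simp add: em)
    also have "(\<integral>\<^sup>+\<omega>. ennreal (?f1 \<omega>) * indicator {\<omega> \<in> space N. ?W \<omega> \<in> B} \<omega> \<partial>N)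
        = (\<integral>\<^sup>+\<omega>. indicator {\<omega> \<in> space N. norm (Y 0 \<omega>) > y \<and> ?W \<omega> \<in> B} \<omega> \<partial>N)"
      by (intro nn_integral_cong) (auto simp: indicator_def)
    finally show ?thesis
      by (simp add: nn_integral_cmult)
  qed
  show ?thesis
  proof (cases "y \<ge> 1")
    case True
    then show ?thesis
      by (simp add: ge powr_divide powr_minus_divide)
  next
    case False
    have "emeasure N {\<omega> \<in> space N. norm (Y 0 \<omega>) > y \<and> ?W \<omega> \<in> B} = emeasure N {\<omega> \<in> space N. ?W \<omega> \<in> B}"
    proof (rule emeasure_eq_AE)
      show "AE \<omega> in N. \<omega> \<in> {\<omega> \<in> space N. norm (Y 0 \<omega>) > y \<and> ?W \<omega> \<in> B} \<longleftrightarrow>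
          \<omega> \<in> {\<omega> \<in> space N. ?W \<omega> \<in> B}"
        using AE_norm_Y0_gt_1 by eventually_elim (use False in auto)
    qed measurable
    then show ?thesis
      using False by (simp add: max_def)
  qed
qed

text \<open>Rectangles determine the product measure. For fixed \<open>B\<close>, the law of the
  scaled radius on the event that the spectral window lies in \<open>B\<close> is compared with a
  multiple of the Pareto law on open half-lines, where the preceding product formula
  applies.\<close>

lemma distr_polar:
  assumes c: "c > 0"
  shows "distr N (borel \<Otimes>\<^sub>M borel) (\<lambda>\<omega>. (c * norm (Y 0 \<omega>), window {- int k..int k} \<Theta> \<omega>))
    = pareto c \<alpha> \<Otimes>\<^sub>M distr N borel (window {- int k..int k} \<Theta>)"
proof (rule pair_measure_eqI[symmetric])
  let ?W = "window {- int k..int k} \<Theta>"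
  interpret P: prob_space "pareto c \<alpha>"
    by (rule prob_space_pareto[OF c \<alpha>_pos])
  interpret L: prob_space "distr N borel ?W"
    by (rule N.prob_space_distr) measurable
  show "sigma_finite_measure (pareto c \<alpha>)" "sigma_finite_measure (distr N borel ?W)"
    by unfold_locales
  show "sets (pareto c \<alpha> \<Otimes>\<^sub>M distr N borel ?W)
      = sets (distr N (borel \<Otimes>\<^sub>M borel) (\<lambda>\<omega>. (c * norm (Y 0 \<omega>), ?W \<omega>)))"
    by (auto intro!: sets_pair_measure_cong)
  fix A B assume "A \<in> sets (pareto c \<alpha>)" "B \<in> sets (distr N borel ?W)"
  then have [measurable]: "A \<in> sets borel" "B \<in> sets borel"
    by auto
  let ?D = "{\<omega> \<in> space N. ?W \<omega> \<in> B}"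
  let ?\<mu> = "distr (density N (indicator ?D)) borel (\<lambda>\<omega>. c * norm (Y 0 \<omega>))"
  have em: "emeasure ?\<mu> C = emeasure N {\<omega> \<in> space N. c * norm (Y 0 \<omega>) \<in> C \<and> ?W \<omega> \<in> B}"
    if [measurable]: "C \<in> sets borel" for C
  proof -
    have "emeasure ?\<mu> C = (\<integral>\<^sup>+\<omega>. indicator ?D \<omega> * indicator ((\<lambda>\<omega>. c * norm (Y 0 \<omega>)) -` C \<inter> space N) \<omega> \<partial>N)"
      by (subst emeasure_distr; (subst emeasure_density)?) auto
    also have "\<dots> = (\<integral>\<^sup>+\<omega>. indicator {\<omega> \<in> space N. c * norm (Y 0 \<omega>) \<in> C \<and> ?W \<omega> \<in> B} \<omega> \<partial>N)"
      by (intro nn_integral_cong) (auto simp: indicator_def)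
    finally show ?thesis
      by simp
  qed
  have "?\<mu> = scale_measure (emeasure N ?D) (pareto c \<alpha>)"
  proof (rule measure_eqI_lessThan)
    fix x :: real
    show "emeasure ?\<mu> {x<..} < \<infinity>"
      by (subst em) (auto simp: N.emeasure_eq_measure)
    have "{\<omega> \<in> space N. c * norm (Y 0 \<omega>) \<in> {x<..} \<and> ?W \<omega> \<in> B}
        = {\<omega> \<in> space N. norm (Y 0 \<omega>) > x / c \<and> ?W \<omega> \<in> B}"
      using c by (auto simp: field_simps)
    moreover have "1 / max 1 (x / c) = c / max c x"
      using c by (auto simp: max_def field_simps)
    ultimately show "emeasure ?\<mu> {x<..} = emeasure (scale_measure (emeasure N ?D) (pareto c \<alpha>)) {x<..}"
      using c \<alpha>_pos by (simp add: em spectral_emeasure_independent emeasure_pareto_Ioi mult.commute)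
  qed auto
  then have "emeasure ?\<mu> A = emeasure N ?D * emeasure (pareto c \<alpha>) A"
    by simp
  then have "emeasure N {\<omega> \<in> space N. c * norm (Y 0 \<omega>) \<in> A \<and> ?W \<omega> \<in> B}
      = emeasure N ?D * emeasure (pareto c \<alpha>) A"
    by (simp add: em)
  moreover have "emeasure (distr N borel ?W) B = emeasure N ?D"
    by (subst emeasure_distr) (auto intro!: arg_cong[where f="emeasure N"])
  moreover have "emeasure (distr N (borel \<Otimes>\<^sub>M borel) (\<lambda>\<omega>. (c * norm (Y 0 \<omega>), ?W \<omega>))) (A \<times> B)
      = emeasure N {\<omega> \<in> space N. c * norm (Y 0 \<omega>) \<in> A \<and> ?W \<omega> \<in> B}"
    by (subst emeasure_distr) (auto intro!: arg_cong[where f="emeasure N"])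
  ultimately show "emeasure (pareto c \<alpha>) A * emeasure (distr N borel ?W) B
      = emeasure (distr N (borel \<Otimes>\<^sub>M borel) (\<lambda>\<omega>. (c * norm (Y 0 \<omega>), ?W \<omega>))) (A \<times> B)"
    by (simp add: mult.commute)
qed

end

section \<open>From the polar law to statements about multiples of \<open>Y\<close>\<close>

lemma borel_measurable_scaled_sequence [measurable]:
  fixes Z :: "'i::countable \<Rightarrow> 'w \<Rightarrow> 'a::euclidean_space"
  assumes [measurable]: "\<And>t. Z t \<in> borel_measurable M" "c \<in> borel_measurable M"
  shows "(\<lambda>\<omega> t. c \<omega> *\<^sub>R Z t \<omega>) \<in> borel_measurable M"
  by (rule measurable_coordinatewise_then_product) measurable

context tail_process_space
begin

text \<open>Fubini for null sets, followed by \<open>c * norm (Y 0)\<close> times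
  \<open>\<Theta>\<close> being \<open>c\<close> times \<open>Y\<close> almost surely. It turns the
  iterated form of \<open>ae_continuous\<close>, almost every radius and then almost every
  \<open>\<omega>\<close>, into almost sure continuity at the tail process.\<close>

lemma AE_polar:
  assumes c: "c > 0" and [measurable]: "Measurable.pred borel P"
    and AE: "AE z in pareto c \<alpha>. AE \<omega> in N. P (\<lambda>i. z *\<^sub>R window {- int k..int k} \<Theta> \<omega> i)"
  shows "AE \<omega> in N. P (\<lambda>i. c *\<^sub>R window {- int k..int k} Y \<omega> i)"
proof -
  let ?W = "window {- int k..int k} \<Theta>"
  interpret P: prob_space "pareto c \<alpha>"
    by (rule prob_space_pareto[OF c \<alpha>_pos])
  interpret L: prob_space "distr N borel ?W"
    by (rule N.prob_space_distr) measurable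
  interpret PL: pair_prob_space "pareto c \<alpha>" "distr N borel ?W" ..
  let ?Q = "\<lambda>p. P (\<lambda>i. fst p *\<^sub>R snd p i)"
  have "(\<lambda>p :: real \<times> (int \<Rightarrow> 'a). (\<lambda>i. fst p *\<^sub>R snd p i)) \<in> borel \<Otimes>\<^sub>M borel \<rightarrow>\<^sub>M borel"
    by (rule measurable_coordinatewise_then_product) measurable
  then have [measurable]: "Measurable.pred (borel \<Otimes>\<^sub>M borel) ?Q"
    by measurable
  have [measurable]: "(\<lambda>v :: int \<Rightarrow> 'a. \<lambda>i. z *\<^sub>R v i) \<in> borel_measurable borel" for z :: real
    by measurable
  have "AE p in pareto c \<alpha> \<Otimes>\<^sub>M distr N borel ?W. ?Q p"
  proof (rule PL.AE_pair_measure)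
    have "Measurable.pred (pareto c \<alpha> \<Otimes>\<^sub>M distr N borel ?W) ?Q"
      by measurable
    then show "{p \<in> space (pareto c \<alpha> \<Otimes>\<^sub>M distr N borel ?W). ?Q p}
        \<in> sets (pareto c \<alpha> \<Otimes>\<^sub>M distr N borel ?W)"
      by (simp add: pred_def)
    show "AE z in pareto c \<alpha>. AE v in distr N borel ?W. ?Q (z, v)"
      using AE
    proof eventually_elim
      case (elim z)
      then show ?case
        by (subst AE_distr_iff) auto
    qed
  qed
  then have "AE \<omega> in N. ?Q (c * norm (Y 0 \<omega>), ?W \<omega>)"
    unfolding distr_polar[OF c, symmetric] by (subst (asm) AE_distr_iff) auto
  then show ?thesis
    using AE_norm_Y0_gt_1
  proof eventually_elim
    case (elim \<omega>)
    have "norm (Y 0 \<omega>) * inverse (norm (Y 0 \<omega>)) = 1"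
      using elim(2) by (intro right_inverse) auto
    then have "(c * norm (Y 0 \<omega>)) *\<^sub>R ?W \<omega> i = c *\<^sub>R window {- int k..int k} Y \<omega> i" for i
      by (auto simp: window_def \<Theta>_def)
    with elim(1) show ?case
      by simp
  qed
qed

text \<open>Fubini for the factorised law of radius and spectral window; boundedness of
  \<open>G\<close> gives integrability on a probability space.\<close>

lemma integral_polar:
  fixes G :: "(int \<Rightarrow> 'a) \<Rightarrow> complex"
  assumes c: "c > 0" and [measurable]: "G \<in> borel_measurable borel" and bd: "\<And>v. norm (G v) \<le> C"
  shows "(\<integral>\<omega>. G (\<lambda>i. c *\<^sub>R window {- int k..int k} Y \<omega> i) \<partial>N)
    = (\<integral>z. (\<integral>\<omega>. G (\<lambda>i. z *\<^sub>R window {- int k..int k} \<Theta> \<omega> i) \<partial>N) \<partial>pareto c \<alpha>)"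
proof -
  let ?W = "window {- int k..int k} \<Theta>"
  interpret P: prob_space "pareto c \<alpha>"
    by (rule prob_space_pareto[OF c \<alpha>_pos])
  interpret L: prob_space "distr N borel ?W"
    by (rule N.prob_space_distr) measurable
  interpret PL: pair_prob_space "pareto c \<alpha>" "distr N borel ?W" ..
  let ?Q = "\<lambda>p. G (\<lambda>i. fst p *\<^sub>R snd p i)"
  have "(\<lambda>p :: real \<times> (int \<Rightarrow> 'a). (\<lambda>i. fst p *\<^sub>R snd p i)) \<in> borel \<Otimes>\<^sub>M borel \<rightarrow>\<^sub>M borel"
    by (rule measurable_coordinatewise_then_product) measurable
  then have Q [measurable]: "?Q \<in> borel_measurable (borel \<Otimes>\<^sub>M borel)"
    by measurable
  have [measurable]: "(\<lambda>v :: int \<Rightarrow> 'a. \<lambda>i. z *\<^sub>R v i) \<in> borel_measurable borel" for z :: real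
    by measurable
  have "(\<integral>\<omega>. G (\<lambda>i. c *\<^sub>R window {- int k..int k} Y \<omega> i) \<partial>N)
      = (\<integral>\<omega>. ?Q (c * norm (Y 0 \<omega>), ?W \<omega>) \<partial>N)"
  proof (rule integral_cong_AE)
    show "AE \<omega> in N. G (\<lambda>i. c *\<^sub>R window {- int k..int k} Y \<omega> i) = ?Q (c * norm (Y 0 \<omega>), ?W \<omega>)"
      using AE_norm_Y0_gt_1
    proof eventually_elim
      case (elim \<omega>)
      have "norm (Y 0 \<omega>) * inverse (norm (Y 0 \<omega>)) = 1"
        using elim by (intro right_inverse) auto
      then have "(c * norm (Y 0 \<omega>)) *\<^sub>R ?W \<omega> i = c *\<^sub>R window {- int k..int k} Y \<omega> i" for i
        by (auto simp: window_def \<Theta>_def)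
      then show ?case
        by simp
    qed
    have [measurable]: "window {- int k..int k} Y \<in> borel_measurable N"
      by measurable
    show "(\<lambda>\<omega>. G (\<lambda>i. c *\<^sub>R window {- int k..int k} Y \<omega> i)) \<in> borel_measurable N"
      by measurable
    show "(\<lambda>\<omega>. ?Q (c * norm (Y 0 \<omega>), ?W \<omega>)) \<in> borel_measurable N"
      by (rule measurable_compose[OF _ Q]) measurable
  qed
  also have "\<dots> = (\<integral>p. ?Q p \<partial>distr N (borel \<Otimes>\<^sub>M borel) (\<lambda>\<omega>. (c * norm (Y 0 \<omega>), ?W \<omega>)))"
    by (rule integral_distr[symmetric]) measurable
  also have "\<dots> = (\<integral>p. ?Q p \<partial>(pareto c \<alpha> \<Otimes>\<^sub>M distr N borel ?W))"
    by (simp add: distr_polar[OF c])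
  also have "\<dots> = (\<integral>z. (\<integral>v. ?Q (z, v) \<partial>distr N borel ?W) \<partial>pareto c \<alpha>)"
  proof (rule PL.integral_fst'[symmetric])
    show "integrable (pareto c \<alpha> \<Otimes>\<^sub>M distr N borel ?W) ?Q"
      by (rule PL.integrable_const_bound[of _ C]) (use bd in \<open>auto cong: measurable_cong_sets\<close>)
  qed
  also have "\<dots> = (\<integral>z. (\<integral>\<omega>. G (\<lambda>i. z *\<^sub>R ?W \<omega> i) \<partial>N) \<partial>pareto c \<alpha>)"
    by (intro Bochner_Integration.integral_cong refl, subst integral_distr) auto
  finally show ?thesis .
qed

end

section \<open>Block functionals\<close>

text \<open>The bound \<open>C\<close> is taken strictly positive so that it can stand in a
  denominator when the error is distributed.\<close>

locale tail_functional = tail_process_space M X \<alpha> N Y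
  for M :: "'w measure" and X :: "int \<Rightarrow> 'w \<Rightarrow> 'a::euclidean_space" and \<alpha> N and Y :: "int \<Rightarrow> 'v \<Rightarrow> 'a" +
  fixes \<epsilon> C :: real and f :: "'a list \<Rightarrow> complex"
  assumes \<epsilon>_pos: "\<epsilon> > 0"
    and C_pos: "C > 0"
    and f_bound: "norm (f xs) \<le> C"
    and f_cond: "condition_C N \<Theta> \<epsilon> f"
begin

text \<open>Reading \<open>f\<close> off a window of a two-sided sequence turns a time shift into a
  change of \<open>s\<close>, which is the form needed for stationarity.\<close>

definition block :: "int \<Rightarrow> nat \<Rightarrow> (int \<Rightarrow> 'a) \<Rightarrow> complex" where
  "block s l v = f (map (\<lambda>i. v (s + int i)) [0..<l])"

lemma block_0 [simp]: "block s 0 v = 0"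
  using f_cond by (simp add: block_def condition_C_def)

lemma norm_block_le: "norm (block s l v) \<le> C"
  by (simp add: block_def f_bound)

lemma block_shift: "block s l (\<lambda>t. v (t + h)) = block (s + h) l v"
  by (simp add: block_def add_ac)

lemma block_cong:
  assumes "\<And>i. i < l \<Longrightarrow> v (s + int i) = w (s + int i)"
  shows "block s l v = block s l w"
  unfolding block_def by (rule arg_cong[where f=f]) (use assms in auto)

text \<open>The trimming clause of \<open>condition_C\<close> leaves a nonempty middle part, so
  \<open>k = 0\<close> needs the separate clause that \<open>f\<close> vanishes on lists of small
  entries.\<close>

lemma block_trim_right:
  assumes kl: "k \<le> l" and small: "\<And>i. k \<le> i \<Longrightarrow> i < l \<Longrightarrow> norm (v (s + int i)) \<le> \<epsilon>"
  shows "block s l v = block s k v"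
proof (cases "k = 0")
  case True
  have "\<forall>x \<in> set (map (\<lambda>i. v (s + int i)) [0..<l]). norm x \<le> \<epsilon>"
    using small True by auto
  then have "block s l v = 0"
    using f_cond unfolding block_def condition_C_def by blast
  then show ?thesis
    using True by simp
next
  case False
  let ?xs = "map (\<lambda>i. v (s + int i)) [0..<l]"
  have "f ?xs = f (map (\<lambda>i. ?xs ! (i - 1)) [1..<k + 1])"
  proof -
    have "1 \<le> (1::nat) \<and> 1 \<le> k \<and> k \<le> length ?xs \<and>
        (\<forall>i \<in> {1..1 - 1} \<union> {k + 1..length ?xs}. norm (?xs ! (i - 1)) \<le> \<epsilon>)"
      using False kl small by auto
    then show ?thesis
      using f_cond unfolding condition_C_def by blast
  qed
  also have "map (\<lambda>i. ?xs ! (i - 1)) [1..<k + 1] = map (\<lambda>i. v (s + int i)) [0..<k]"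
    using kl by (intro nth_equalityI) (auto simp del: upt_Suc)
  finally show ?thesis
    by (simp add: block_def)
qed

lemma block_trim_left:
  assumes small: "norm (v s) \<le> \<epsilon>"
  shows "block s (Suc l) v = block (s + 1) l v"
proof (cases "l = 0")
  case True
  then show ?thesis
    using block_trim_right[of 0 1 v s] small by simp
next
  case False
  let ?xs = "map (\<lambda>i. v (s + int i)) [0..<Suc l]"
  \<comment> \<open>Indices in the trimming clause start at 1, so removing the head means
    \<open>j1 = 2\<close>; this is admissible only if something remains, hence the split on
    \<open>l = 0\<close>.\<close>
  have "f ?xs = f (map (\<lambda>i. ?xs ! (i - 1)) [2..<Suc l + 1])"
  proof -
    have "1 \<le> (2::nat) \<and> 2 \<le> Suc l \<and> Suc l \<le> length ?xs \<and>
        (\<forall>i \<in> {1..2 - 1} \<union> {Suc l + 1..length ?xs}. norm (?xs ! (i - 1)) \<le> \<epsilon>)"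
      using False small by (auto simp del: upt_Suc)
    then show ?thesis
      using f_cond unfolding condition_C_def by blast
  qed
  also have "map (\<lambda>i. ?xs ! (i - 1)) [2..<Suc l + 1] = map (\<lambda>i. v (s + 1 + int i)) [0..<l]"
    by (intro nth_equalityI) (auto simp del: upt_Suc simp: algebra_simps)
  finally show ?thesis
    by (simp add: block_def)
qed

text \<open>Padding with zeros does not affect the value and produces exactly the kind of point at
  which \<open>ae_continuous\<close> asserts continuity.\<close>

lemma block_eq_restriction:
  "block s l v = restriction f l (\<lambda>i. if i < l then v (s + int i) else 0)"
  unfolding block_def restriction_def by (rule arg_cong[where f=f]) auto

lemma continuous_on_pad: "continuous_on UNIV (\<lambda>v :: int \<Rightarrow> 'a. \<lambda>i. if i < l then v (s + int i) else 0)"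
proof (rule continuous_on_coordinatewise_then_product)
  show "continuous_on UNIV (\<lambda>v :: int \<Rightarrow> 'a. if i < l then v (s + int i) else 0)" for i
    by (cases "i < l") (auto intro: continuous_on_product_coordinates)
qed

lemma restriction_meas [measurable]: "restriction f l \<in> borel_measurable borel"
proof (cases "l = 0")
  case True
  then have "restriction f l = (\<lambda>_. f [])"
    by (auto simp: restriction_def)
  then show ?thesis
    by simp
next
  case False
  then show ?thesis
    using f_cond by (simp add: condition_C_def)
qed

lemma block_meas [measurable]: "block s l \<in> borel_measurable borel"
proof -
  have "(\<lambda>v. restriction f l (\<lambda>i. if i < l then v (s + int i) else 0)) \<in> borel_measurable borel"
    by (rule measurable_compose[OF borel_measurable_continuous_onI[OF continuous_on_pad] restriction_meas])
  then show ?thesis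
    by (simp add: block_eq_restriction[abs_def])
qed

lemma isCont_block:
  assumes "isCont (restriction f l) (\<lambda>i. if i < l then v (s + int i) else 0)"
  shows "isCont (block s l) v"
proof -
  let ?p = "\<lambda>v :: int \<Rightarrow> 'a. \<lambda>i. if i < l then v (s + int i) else 0"
  have "isCont ?p v"
    using continuous_on_pad by (simp add: continuous_on_eq_continuous_at)
  then have "isCont (\<lambda>v. restriction f l (?p v)) v"
    by (rule isCont_o2[of _ ?p]) (rule assms)
  then show ?thesis
    by (simp add: block_eq_restriction[abs_def])
qed

section \<open>Increments of block functionals and their limit at a fixed length\<close>

definition incr :: "nat \<Rightarrow> (int \<Rightarrow> 'a) \<Rightarrow> complex" where
  "incr k v = block 0 (Suc k) v - block 1 k v"

lemma incr_meas [measurable]: "incr k \<in> borel_measurable borel"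
  unfolding incr_def[abs_def] by measurable

lemma norm_incr_le: "norm (incr k v) \<le> 2 * C"
  unfolding incr_def using norm_block_le[of 0 "Suc k" v] norm_block_le[of 1 k v] norm_triangle_ineq4[of "block 0 (Suc k) v" "block 1 k v"]
  by linarith

lemma incr_eq_0: "norm (v 0) \<le> \<epsilon> \<Longrightarrow> incr k v = 0"
  using block_trim_left[of v 0 k] by (simp add: incr_def)

text \<open>Both blocks of an increment end at the same time, so the small entries at times
  \<open>k + 1\<close> to \<open>m\<close> are trimmed from both. This is where an event without
  late exceedances makes the length of the block irrelevant.\<close>

lemma incr_eq:
  assumes "k \<le> m" and small: "\<And>i. k < i \<Longrightarrow> i \<le> m \<Longrightarrow> norm (v (int i)) \<le> \<epsilon>"
  shows "incr m v = incr k v"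
proof -
  have "block 0 (Suc m) v = block 0 (Suc k) v"
    by (rule block_trim_right) (use assms in auto)
  moreover have "block 1 m v = block 1 k v"
  proof (rule block_trim_right)
    show "norm (v (1 + int i)) \<le> \<epsilon>" if "k \<le> i" "i < m" for i
      using small[of "Suc i"] that by simp
  qed (use assms in auto)
  ultimately show ?thesis
    by (simp add: incr_def)
qed

lemma incr_cong:
  assumes "\<And>i. 0 \<le> i \<Longrightarrow> i \<le> int k \<Longrightarrow> v i = w i"
  shows "incr k v = incr k w"
  unfolding incr_def by (intro arg_cong2[where f="(-)"] block_cong assms) auto

text \<open>The two blocks start at \<open>s = 0\<close> and \<open>s = 1\<close>, and
  \<open>ae_continuous\<close> covers every starting time. A null set of radii for Lebesgue measure
  is null for the Pareto law, so \<open>AE_polar\<close> transfers the property to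
  \<open>\<epsilon>\<close> times \<open>Y\<close>.\<close>

lemma AE_isCont_incr:
  "AE \<omega> in N. isCont (incr k) (\<lambda>i. \<epsilon> *\<^sub>R window {- int k..int k} Y \<omega> i)"
proof (rule AE_polar[OF \<epsilon>_pos])
  let ?W = "window {- int k..int k} \<Theta>"
  have block: "AE y in lborel. 0 < y \<longrightarrow> (AE \<omega> in N. isCont (block s l) (\<lambda>i. y *\<^sub>R ?W \<omega> i))"
    if s: "0 \<le> s" "s + int l \<le> int k + 1" for s l
  proof (cases "l = 0")
    case True
    then have "block s l = (\<lambda>_. 0)"
      by auto
    then show ?thesis
      by simp
  next
    case False
    then have "AE y in lborel. 0 < y \<longrightarrow>
        (AE \<omega> in N. isCont (restriction f l) (\<lambda>i. if i < l then y *\<^sub>R \<Theta> (s + int i) \<omega> else 0))"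
      using f_cond by (simp add: condition_C_def ae_continuous_def)
    moreover have "(\<lambda>i. if i < l then y *\<^sub>R \<Theta> (s + int i) \<omega> else 0) =
        (\<lambda>i. if i < l then y *\<^sub>R ?W \<omega> (s + int i) else 0)" for y \<omega>
      using s by (auto simp: fun_eq_iff window_def)
    ultimately have "AE y in lborel. 0 < y \<longrightarrow>
        (AE \<omega> in N. isCont (restriction f l) (\<lambda>i. if i < l then y *\<^sub>R ?W \<omega> (s + int i) else 0))"
      by simp
    then show ?thesis
    proof eventually_elim
      case (elim y)
      show ?case
      proof
        assume "0 < y"
        with elim have "AE \<omega> in N. isCont (restriction f l) (\<lambda>i. if i < l then y *\<^sub>R ?W \<omega> (s + int i) else 0)"
          by simp
        then show "AE \<omega> in N. isCont (block s l) (\<lambda>i. y *\<^sub>R ?W \<omega> i)"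
          by eventually_elim (rule isCont_block)
      qed
    qed
  qed
  have "AE y in lborel. 0 < y \<longrightarrow> (AE \<omega> in N. isCont (block 0 (Suc k)) (\<lambda>i. y *\<^sub>R ?W \<omega> i))"
    "AE y in lborel. 0 < y \<longrightarrow> (AE \<omega> in N. isCont (block 1 k) (\<lambda>i. y *\<^sub>R ?W \<omega> i))"
    by (rule block; simp)+
  then have "AE y in lborel. \<epsilon> < y \<longrightarrow> (AE \<omega> in N. isCont (incr k) (\<lambda>i. y *\<^sub>R ?W \<omega> i))"
  proof eventually_elim
    case (elim y)
    show ?case
    proof
      assume "\<epsilon> < y"
      then have "0 < y"
        using \<epsilon>_pos by simp
      with elim have "AE \<omega> in N. isCont (block 0 (Suc k)) (\<lambda>i. y *\<^sub>R ?W \<omega> i)"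
        "AE \<omega> in N. isCont (block 1 k) (\<lambda>i. y *\<^sub>R ?W \<omega> i)"
        by auto
      then show "AE \<omega> in N. isCont (incr k) (\<lambda>i. y *\<^sub>R ?W \<omega> i)"
        unfolding incr_def[abs_def] by eventually_elim (rule continuous_diff)
    qed
  qed
  then show "AE y in pareto \<epsilon> \<alpha>. AE \<omega> in N. isCont (incr k) (\<lambda>i. y *\<^sub>R ?W \<omega> i)"
    using \<epsilon>_pos \<alpha>_pos by (simp add: AE_pareto_iff)
\<comment> \<open>The remaining goal is measurability: the continuity points of a map between metric
  spaces form a G-delta set.\<close>
qed measurable

definition incr_mean :: "nat \<Rightarrow> real \<Rightarrow> complex" where
  "incr_mean k y = (\<integral>\<omega>. incr k (\<lambda>t. y *\<^sub>R \<Theta> t \<omega>) \<partial>N)"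

text \<open>An inequality that holds for every \<open>\<omega>\<close>, including those with
  \<open>Y 0 \<omega> = 0\<close>, where \<open>\<Theta> 0 \<omega>\<close> is 0 because
  \<open>inverse 0 = 0\<close>. Increments at radius at most \<open>\<epsilon>\<close> thus vanish
  pointwise.\<close>

lemma norm_\<Theta>_0_le: "norm (\<Theta> 0 \<omega>) \<le> 1"
  by (cases "Y 0 \<omega> = 0") (auto simp: \<Theta>_def)

lemma incr_scaled_eq_0:
  assumes "0 < y" "y \<le> \<epsilon>"
  shows "incr k (\<lambda>t. y *\<^sub>R \<Theta> t \<omega>) = 0"
proof (rule incr_eq_0)
  have "y * norm (\<Theta> 0 \<omega>) \<le> \<epsilon> * 1"
    using assms norm_\<Theta>_0_le by (intro mult_mono) auto
  then show "norm (y *\<^sub>R \<Theta> 0 \<omega>) \<le> \<epsilon>"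
    using assms by simp
qed

lemma borel_measurable_scaled_mean:
  fixes H :: "(int \<Rightarrow> 'a) \<Rightarrow> complex"
  assumes [measurable]: "H \<in> borel_measurable borel"
  shows "(\<lambda>y. \<integral>\<omega>. H (\<lambda>t. y *\<^sub>R \<Theta> t \<omega>) \<partial>N) \<in> borel_measurable borel"
proof (rule N.borel_measurable_lebesgue_integral)
  have "(\<lambda>p. \<lambda>t. fst p *\<^sub>R \<Theta> t (snd p)) \<in> borel \<Otimes>\<^sub>M N \<rightarrow>\<^sub>M borel"
    by (rule measurable_coordinatewise_then_product) measurable
  then show "case_prod (\<lambda>y \<omega>. H (\<lambda>t. y *\<^sub>R \<Theta> t \<omega>)) \<in> borel_measurable (borel \<Otimes>\<^sub>M N)"
    unfolding case_prod_beta by measurable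
qed

lemma incr_mean_meas [measurable]: "incr_mean k \<in> borel_measurable borel"
  unfolding incr_mean_def[abs_def] by (rule borel_measurable_scaled_mean) measurable

lemma norm_incr_mean_le: "norm (incr_mean k y) \<le> 2 * C"
proof -
  have "norm (incr_mean k y) \<le> (\<integral>\<omega>. 2 * C \<partial>N)"
    unfolding incr_mean_def by (rule norm_integral_le_integral)
      (auto intro!: N.integrable_const_bound[of _ "2 * C"] norm_incr_le)
  then show ?thesis
    by (simp add: N.prob_space)
qed

lemma incr_mean_eq_0: "0 < y \<Longrightarrow> y \<le> \<epsilon> \<Longrightarrow> incr_mean k y = 0"
  by (simp add: incr_mean_def incr_scaled_eq_0)

text \<open>An increment vanishes unless \<open>norm (X 0) > \<epsilon> * x\<close>, so the tail
  limit is taken at level \<open>\<epsilon> * x\<close> for the functional \<open>incr k\<close>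
  rescaled by \<open>\<epsilon>\<close>. The scale cancels in the argument, and
  \<open>incr_mean k\<close> vanishes on \<open>(0, \<epsilon>]\<close>, as
  \<open>integral_pareto\<close> demands.\<close>

lemma incr_tendsto:
  "((\<lambda>x. (\<integral>\<omega>. incr k (\<lambda>t. X t \<omega> /\<^sub>R x) \<partial>M) / complex_of_real (tail_prob x))
    \<longlongrightarrow> (LINT y:{0<..}|lborel. (\<alpha> * y powr (- \<alpha> - 1)) *\<^sub>R incr_mean k y)) at_top"
proof -
  let ?W = "window {- int k..int k}"
  let ?G = "\<lambda>v :: int \<Rightarrow> 'a. incr k (\<lambda>i. \<epsilon> *\<^sub>R v i)"
  let ?L = "LINT y:{0<..}|lborel. (\<alpha> * y powr (- \<alpha> - 1)) *\<^sub>R incr_mean k y"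
  have sc [measurable]: "(\<lambda>v :: int \<Rightarrow> 'a. \<lambda>i. \<epsilon> *\<^sub>R v i) \<in> borel_measurable borel"
    by measurable
  have "((\<lambda>x. (\<integral>\<omega>. indicator {\<omega> \<in> space M. norm (X 0 \<omega>) > x} \<omega> *\<^sub>R
        ?G (?W (\<lambda>t \<omega>. X t \<omega> /\<^sub>R x) \<omega>) \<partial>M) / complex_of_real (tail_prob x))
     \<longlongrightarrow> (\<integral>\<omega>. ?G (?W Y \<omega>) \<partial>N)) at_top"
  proof (rule tail_tendsto[where C="2 * C"])
    have "continuous_on UNIV (\<lambda>v :: int \<Rightarrow> 'a. \<lambda>i. \<epsilon> *\<^sub>R v i)"
      by (intro continuous_on_coordinatewise_then_product continuous_intros continuous_on_product_coordinates)
    then have "isCont (\<lambda>v :: int \<Rightarrow> 'a. \<lambda>i. \<epsilon> *\<^sub>R v i) v" for v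
      by (simp add: continuous_on_eq_continuous_at)
    from isCont_o2[OF this, where g="incr k"] AE_isCont_incr[of k]
    show "AE \<omega> in N. isCont ?G (?W Y \<omega>)"
      by auto
  qed (auto simp: norm_incr_le)
  also have "(\<integral>\<omega>. ?G (?W Y \<omega>) \<partial>N) = (\<integral>z. (\<integral>\<omega>. incr k (\<lambda>i. z *\<^sub>R ?W \<Theta> \<omega> i) \<partial>N) \<partial>pareto \<epsilon> \<alpha>)"
    by (rule integral_polar[OF \<epsilon>_pos _ norm_incr_le]) measurable
  also have "\<dots> = integral\<^sup>L (pareto \<epsilon> \<alpha>) (incr_mean k)"
    unfolding incr_mean_def
    by (intro Bochner_Integration.integral_cong refl incr_cong) (auto simp: window_def)
  also have "\<dots> = (\<epsilon> powr \<alpha>) *\<^sub>R ?L"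
    by (rule integral_pareto[OF \<epsilon>_pos \<alpha>_pos _ incr_mean_eq_0]) auto
  finally have lim: "((\<lambda>x. (\<integral>\<omega>. indicator {\<omega> \<in> space M. norm (X 0 \<omega>) > x} \<omega> *\<^sub>R
        ?G (?W (\<lambda>t \<omega>. X t \<omega> /\<^sub>R x) \<omega>) \<partial>M) / complex_of_real (tail_prob x))
     \<longlongrightarrow> (\<epsilon> powr \<alpha>) *\<^sub>R ?L) at_top" .
  have flt: "filterlim (\<lambda>x. \<epsilon> * x) at_top at_top"
    using \<epsilon>_pos by (intro filterlim_tendsto_pos_mult_at_top[OF tendsto_const] filterlim_ident) auto
  \<comment> \<open>Replacing the normalisation at level \<open>\<epsilon> * x\<close> by the one at
    level \<open>x\<close> multiplies by the tail ratio; its limit cancels the factor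
    \<open>\<epsilon> powr \<alpha>\<close> of the Pareto density.\<close>
  have "((\<lambda>x. complex_of_real (tail_prob (\<epsilon> * x) / tail_prob x) *
      ((\<integral>\<omega>. indicator {\<omega> \<in> space M. norm (X 0 \<omega>) > \<epsilon> * x} \<omega> *\<^sub>R
        ?G (?W (\<lambda>t \<omega>. X t \<omega> /\<^sub>R (\<epsilon> * x)) \<omega>) \<partial>M) / complex_of_real (tail_prob (\<epsilon> * x))))
     \<longlongrightarrow> complex_of_real (\<epsilon> powr (- \<alpha>)) * ((\<epsilon> powr \<alpha>) *\<^sub>R ?L)) at_top"
    by (intro tendsto_mult tendsto_of_real tail_prob_ratio filterlim_compose[OF lim flt] \<epsilon>_pos)
  also have "complex_of_real (\<epsilon> powr (- \<alpha>)) * ((\<epsilon> powr \<alpha>) *\<^sub>R ?L) = ?L"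
  proof -
    have "\<epsilon> powr (- \<alpha>) * \<epsilon> powr \<alpha> = 1"
      using \<epsilon>_pos by (simp flip: powr_add)
    then show ?thesis
      by (simp add: scaleR_conv_of_real mult.assoc[symmetric] flip: of_real_mult)
  qed
  finally show ?thesis
  proof (rule Lim_transform_eventually)
    have "\<forall>\<^sub>F x in at_top. tail_prob (\<epsilon> * x) > 0"
      using tail_prob_pos flt by (rule eventually_compose_filterlim)
    then show "\<forall>\<^sub>F x in at_top. complex_of_real (tail_prob (\<epsilon> * x) / tail_prob x) *
      ((\<integral>\<omega>. indicator {\<omega> \<in> space M. norm (X 0 \<omega>) > \<epsilon> * x} \<omega> *\<^sub>R
        ?G (?W (\<lambda>t \<omega>. X t \<omega> /\<^sub>R (\<epsilon> * x)) \<omega>) \<partial>M) / complex_of_real (tail_prob (\<epsilon> * x)))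
      = (\<integral>\<omega>. incr k (\<lambda>t. X t \<omega> /\<^sub>R x) \<partial>M) / complex_of_real (tail_prob x)"
      using eventually_gt_at_top[of 0]
    proof eventually_elim
      case (elim x)
      have "(\<integral>\<omega>. indicator {\<omega> \<in> space M. norm (X 0 \<omega>) > \<epsilon> * x} \<omega> *\<^sub>R
          ?G (?W (\<lambda>t \<omega>. X t \<omega> /\<^sub>R (\<epsilon> * x)) \<omega>) \<partial>M) = (\<integral>\<omega>. incr k (\<lambda>t. X t \<omega> /\<^sub>R x) \<partial>M)"
      proof (rule Bochner_Integration.integral_cong)
        fix \<omega> assume "\<omega> \<in> space M"
        have "?G (?W (\<lambda>t \<omega>. X t \<omega> /\<^sub>R (\<epsilon> * x)) \<omega>) = incr k (\<lambda>t. X t \<omega> /\<^sub>R x)"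
          using \<epsilon>_pos by (intro incr_cong) (auto simp: window_def)
        moreover have "incr k (\<lambda>t. X t \<omega> /\<^sub>R x) = 0" if "\<not> norm (X 0 \<omega>) > \<epsilon> * x"
          using that elim by (intro incr_eq_0) (auto simp: field_simps)
        ultimately show "indicator {\<omega> \<in> space M. norm (X 0 \<omega>) > \<epsilon> * x} \<omega> *\<^sub>R
            ?G (?W (\<lambda>t \<omega>. X t \<omega> /\<^sub>R (\<epsilon> * x)) \<omega>) = incr k (\<lambda>t. X t \<omega> /\<^sub>R x)"
          using \<open>\<omega> \<in> space M\<close> by (auto simp: indicator_def)
      qed simp
      with elim show ?case
        by simp
    qed
  qed
qed

end

section \<open>Anti-clustering\<close>

text \<open>Uniformity over \<open>\<Lambda> n\<close> costs nothing for statements about large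
  \<open>x\<close>, because all of \<open>\<Lambda> n\<close> lies beyond its infimum; positivity
  ensures that the infimum is a lower bound.\<close>

lemma eventually_ge_on:
  fixes \<Lambda> :: "nat \<Rightarrow> real set"
  assumes pos: "\<And>n. \<Lambda> n \<subseteq> {0<..}" and inf: "filterlim (\<lambda>n. Inf (\<Lambda> n)) at_top sequentially"
    and ev: "\<forall>\<^sub>F x in at_top. P x"
  shows "\<forall>\<^sub>F n in sequentially. \<forall>x\<in>\<Lambda> n. P x"
proof -
  obtain x0 where x0: "\<And>x. x \<ge> x0 \<Longrightarrow> P x"
    using ev by (auto simp: eventually_at_top_linorder)
  have "\<forall>\<^sub>F n in sequentially. x0 \<le> Inf (\<Lambda> n)"
    using inf by (simp add: filterlim_at_top)
  then show ?thesis
  proof eventually_elim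
    case (elim n)
    have "Inf (\<Lambda> n) \<le> x" if "x \<in> \<Lambda> n" for x
      using that pos[of n] by (intro cInf_lower bdd_belowI[of _ 0]) auto
    with elim x0 show ?case
      by (meson order_trans)
  qed
qed

lemma tendsto_0_ennrealI:
  fixes u :: "'i \<Rightarrow> ennreal"
  assumes "\<And>e. e > 0 \<Longrightarrow> \<forall>\<^sub>F i in F. u i \<le> ennreal e"
  shows "(u \<longlongrightarrow> 0) F"
proof (rule order_tendstoI)
  fix a :: ennreal assume "0 < a"
  then obtain d where d: "0 < d" "d < a"
    using dense by blast
  then have "d \<noteq> \<top>"
    by auto
  then obtain r where r: "d = ennreal r" "r \<ge> 0"
    by (cases d) auto
  with d have "r > 0"
    by auto
  from assms[OF this] show "\<forall>\<^sub>F i in F. u i < a"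
    by eventually_elim (use d r in auto)
qed simp

section \<open>Joint exceedances and decay of the spectral tail process\<close>

context tail_process_space
begin

definition exceed :: "nat \<Rightarrow> nat \<Rightarrow> real \<Rightarrow> real" where
  "exceed k n u = prob {\<omega> \<in> space M. (\<exists>i\<in>{k..n}. norm (X (int i) \<omega>) > u) \<and> norm (X 0 \<omega>) > u}"

lemma exceed_nonneg [simp]: "exceed k n u \<ge> 0"
  by (simp add: exceed_def)

lemma exceed_le_tail_prob: "exceed k n u \<le> tail_prob u"
  unfolding exceed_def tail_prob_def by (intro finite_measure_mono) auto

lemma integral_stationary:
  fixes G :: "(int \<Rightarrow> 'a) \<Rightarrow> complex"
  assumes st: "strictly_stationary M X" and [measurable]: "G \<in> borel_measurable borel"
  shows "(\<integral>\<omega>. G (\<lambda>t. X (t + h) \<omega>) \<partial>M) = (\<integral>\<omega>. G (\<lambda>t. X t \<omega>) \<partial>M)"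
proof -
  have [measurable]: "(\<lambda>\<omega> t. X (t + h) \<omega>) \<in> borel_measurable M" for h
    by (rule measurable_coordinatewise_then_product) measurable
  have "(\<integral>\<omega>. G (\<lambda>t. X (t + h) \<omega>) \<partial>M) = integral\<^sup>L (distr M borel (\<lambda>\<omega> t. X (t + h) \<omega>)) G" for h
    by (rule integral_distr[symmetric]) measurable
  from this[of h] this[of 0] show ?thesis
    using st by (simp add: strictly_stationary_def)
qed

lemma integrable_bounded_functional:
  fixes G :: "(int \<Rightarrow> 'a) \<Rightarrow> complex"
  assumes [measurable]: "G \<in> borel_measurable borel" and "\<And>v. norm (G v) \<le> D"
  shows "integrable M (\<lambda>\<omega>. G (\<lambda>t. X t \<omega> /\<^sub>R x))"
  by (rule integrable_const_bound[of _ D]) (use assms in auto)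

text \<open>The iterated limit with its quantifiers unfolded. The inequality is kept in product
  form, which makes sense for every \<open>x\<close>, including levels of zero tail
  probability.\<close>

lemma uniform_exceed_le:
  assumes ac: "uniform_anti_clustering M X \<Lambda>" and "\<delta> > 0" "b > 0"
  shows "\<exists>K. \<forall>k\<ge>K. \<forall>\<^sub>F n in sequentially. \<forall>x\<in>\<Lambda> n. exceed k n (x * \<delta>) \<le> b * tail_prob (x * \<delta>)"
proof -
  let ?p = "\<lambda>k n x. \<P>(\<omega> in M. (\<exists>i\<in>{k..n}. norm (X (int i) \<omega>) > x * \<delta>) \<bar> norm (X 0 \<omega>) > x * \<delta>)"
  have p: "?p k n x = exceed k n (x * \<delta>) / tail_prob (x * \<delta>)" for k n x
    by (simp add: cond_prob_def exceed_def tail_prob_def)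
  have "(\<lambda>k. limsup (\<lambda>n. SUP x \<in> \<Lambda> n. ennreal (?p k n x))) \<longlonglongrightarrow> 0"
    using ac \<open>\<delta> > 0\<close> unfolding uniform_anti_clustering_def by blast
  then have "\<forall>\<^sub>F k in sequentially. limsup (\<lambda>n. SUP x \<in> \<Lambda> n. ennreal (?p k n x)) < ennreal b"
    using \<open>b > 0\<close> by (intro order_tendstoD) auto
  then obtain K where K: "\<And>k. k \<ge> K \<Longrightarrow> limsup (\<lambda>n. SUP x \<in> \<Lambda> n. ennreal (?p k n x)) < ennreal b"
    by (auto simp: eventually_at_top_linorder)
  have "\<forall>\<^sub>F n in sequentially. \<forall>x\<in>\<Lambda> n. exceed k n (x * \<delta>) \<le> b * tail_prob (x * \<delta>)" if "k \<ge> K" for k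
    using Limsup_lessD[OF K[OF that]]
  proof eventually_elim
    case (elim n)
    show ?case
    proof
      fix x assume "x \<in> \<Lambda> n"
      then have "ennreal (?p k n x) \<le> (SUP x \<in> \<Lambda> n. ennreal (?p k n x))"
        by (rule SUP_upper)
      also note elim
      finally have lt: "exceed k n (x * \<delta>) / tail_prob (x * \<delta>) < b"
        using \<open>b > 0\<close> by (simp add: p ennreal_less_iff)
      show "exceed k n (x * \<delta>) \<le> b * tail_prob (x * \<delta>)"
      \<comment> \<open>If the conditioning event is null, the conditional probability is 0 by the
        convention for division and carries no information, but then \<open>exceed\<close> is 0 as
        well.\<close>
      proof (cases "tail_prob (x * \<delta>) = 0")
        case True
        then show ?thesis
          using exceed_le_tail_prob[of k n "x * \<delta>"] by simp
      next
        case False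
        then have "tail_prob (x * \<delta>) > 0"
          using tail_prob_nonneg[of "x * \<delta>"] by linarith
        then show ?thesis
          using lt by (simp add: pos_divide_less_eq less_imp_le)
      qed
    qed
  qed
  then show ?thesis
    by blast
qed

text \<open>Anti-clustering is passed to the limit process, uniformly in the horizon
  \<open>m\<close>. Conditioning is at level \<open>x\<close>, exceedances are counted at level
  \<open>x * \<delta>\<close>; as \<open>\<delta> \<le> 1\<close>, the event for \<open>X 0\<close>
  may be enlarged to that lower level, at the price of the tail ratio with limit
  \<open>\<delta> powr (- \<alpha>)\<close>.\<close>

lemma prob_Y_exceed_le:
  fixes \<Lambda> :: "nat \<Rightarrow> real set"
  assumes pos: "\<And>n. \<Lambda> n \<subseteq> {0<..}" and inf: "filterlim (\<lambda>n. Inf (\<Lambda> n)) at_top sequentially"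
    and ac: "uniform_anti_clustering M X \<Lambda>" and \<delta>: "0 < \<delta>" "\<delta> \<le> 1" and b: "b > 0"
  shows "\<exists>K. \<forall>m. N.prob {\<omega> \<in> space N. \<exists>i\<in>{K..m}. norm (Y (int i) \<omega>) \<ge> 2 * \<delta>} \<le> b * \<delta> powr (- \<alpha>)"
proof -
  obtain K where K: "\<forall>\<^sub>F n in sequentially. \<forall>x\<in>\<Lambda> n. exceed K n (x * \<delta>) \<le> b * tail_prob (x * \<delta>)"
    using uniform_exceed_le[OF ac \<delta>(1) b] by blast
  \<comment> \<open>\<open>Inf {}\<close> is a fixed, unspecified real, so \<open>\<Lambda>\<^sub>n\<close> cannot be empty once \<open>Inf \<Lambda>\<^sub>n\<close> exceeds it.\<close>
  have nonempty: "\<forall>\<^sub>F n in sequentially. \<Lambda> n \<noteq> {}"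
  proof -
    have "\<forall>\<^sub>F n in sequentially. Inf {} + 1 \<le> Inf (\<Lambda> n)"
      using inf by (simp add: filterlim_at_top)
    then show ?thesis
      by eventually_elim auto
  qed
  \<comment> \<open>One point of each \<open>\<Lambda> n\<close> suffices: the bound is uniform in
    \<open>x\<close>, and any selection tends to infinity.\<close>
  define sel where "sel n = (SOME x. x \<in> \<Lambda> n)" for n
  have sel: "\<forall>\<^sub>F n in sequentially. sel n \<in> \<Lambda> n"
    using nonempty by eventually_elim (auto simp: sel_def some_in_eq)
  have sel_lim: "filterlim sel at_top sequentially"
    unfolding filterlim_at_top
  proof
    fix Z
    have "\<forall>\<^sub>F n in sequentially. \<forall>x\<in>\<Lambda> n. Z \<le> x"
      by (rule eventually_ge_on[OF pos inf eventually_ge_at_top])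
    with sel show "\<forall>\<^sub>F n in sequentially. Z \<le> sel n"
      by eventually_elim blast
  qed
  have "N.prob {\<omega> \<in> space N. \<exists>i\<in>{K..m}. norm (Y (int i) \<omega>) \<ge> 2 * \<delta>} \<le> b * \<delta> powr (- \<alpha>)" for m
  proof -
    \<comment> \<open>A continuous substitute for the exceedance indicator: it equals 1 once some
      entry reaches \<open>2 * \<delta>\<close> and vanishes when all entries are at most
      \<open>\<delta>\<close>.\<close>
    define \<phi> where "\<phi> v = min 1 (\<Sum>i=K..m. max 0 (norm (v (int i)) / \<delta> - 1))" for v :: "int \<Rightarrow> 'a"
    have \<phi>_nonneg: "\<phi> v \<ge> 0" and \<phi>_le: "\<phi> v \<le> 1" for v
      by (auto simp: \<phi>_def sum_nonneg)
    have \<phi>_cont: "continuous_on UNIV \<phi>"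
      unfolding \<phi>_def by (intro continuous_intros continuous_on_product_coordinates) (use \<delta> in auto)
    then have [measurable]: "\<phi> \<in> borel_measurable borel"
      by (rule borel_measurable_continuous_onI)
    have \<phi>_pos: "\<exists>i\<in>{K..m}. norm (v (int i)) > \<delta>" if "\<phi> v \<noteq> 0" for v
    proof (rule ccontr)
      assume "\<not> ?thesis"
      then have "(\<Sum>i=K..m. max 0 (norm (v (int i)) / \<delta> - 1)) = 0"
        using \<delta> by (intro sum.neutral) (auto simp: field_simps not_less)
      then show False
        using that by (simp add: \<phi>_def)
    qed
    have \<phi>_eq_1: "\<phi> v = 1" if "i \<in> {K..m}" "norm (v (int i)) \<ge> 2 * \<delta>" for i v
    proof -
      have "1 \<le> max 0 (norm (v (int i)) / \<delta> - 1)"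
        using that \<delta> by (simp add: field_simps)
      also have "\<dots> \<le> (\<Sum>i=K..m. max 0 (norm (v (int i)) / \<delta> - 1))"
        using that by (intro member_le_sum[where f="\<lambda>i. max 0 (norm (v (int i)) / \<delta> - 1)"]) auto
      finally show ?thesis
        by (simp add: \<phi>_def)
    qed
    let ?W = "window {- int m..int m}"
    let ?I = "\<lambda>x. \<integral>\<omega>. indicator {\<omega> \<in> space M. norm (X 0 \<omega>) > x} \<omega> * \<phi> (?W (\<lambda>t \<omega>. X t \<omega> /\<^sub>R x) \<omega>) \<partial>M"
    have W [measurable]: "?W (\<lambda>t \<omega>. X t \<omega> /\<^sub>R x) \<in> borel_measurable M" for x
      by measurable
    have WY [measurable]: "?W Y \<in> borel_measurable N"
      by measurable
    have "((\<lambda>x. (\<integral>\<omega>. indicator {\<omega> \<in> space M. norm (X 0 \<omega>) > x} \<omega> *\<^sub>R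
          complex_of_real (\<phi> (?W (\<lambda>t \<omega>. X t \<omega> /\<^sub>R x) \<omega>)) \<partial>M) / complex_of_real (tail_prob x))
        \<longlongrightarrow> (\<integral>\<omega>. complex_of_real (\<phi> (?W Y \<omega>)) \<partial>N)) at_top"
    proof (rule tail_tendsto[where C=1])
      have "isCont (\<lambda>v. complex_of_real (\<phi> v)) v" for v
        using \<phi>_cont by (auto simp: continuous_on_eq_continuous_at intro!: continuous_intros)
      then show "AE \<omega> in N. isCont (\<lambda>v. complex_of_real (\<phi> v)) (?W Y \<omega>)"
        by simp
    qed (use \<phi>_nonneg \<phi>_le in auto)
    then have "((\<lambda>x. complex_of_real (?I x / tail_prob x)) \<longlongrightarrow> complex_of_real (\<integral>\<omega>. \<phi> (?W Y \<omega>) \<partial>N)) at_top"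
      by (simp add: scaleR_conv_of_real flip: of_real_mult)
    then have "((\<lambda>x. ?I x / tail_prob x) \<longlongrightarrow> (\<integral>\<omega>. \<phi> (?W Y \<omega>) \<partial>N)) at_top"
      by (simp only: tendsto_of_real_iff)
    then have lim1: "(\<lambda>n. ?I (sel n) / tail_prob (sel n)) \<longlonglongrightarrow> (\<integral>\<omega>. \<phi> (?W Y \<omega>) \<partial>N)"
      by (rule filterlim_compose[OF _ sel_lim])
    have lim2: "(\<lambda>n. b * (tail_prob (\<delta> * sel n) / tail_prob (sel n))) \<longlonglongrightarrow> b * \<delta> powr (- \<alpha>)"
      by (intro tendsto_mult tendsto_const filterlim_compose[OF tail_prob_ratio sel_lim] \<delta>)
    \<comment> \<open>The range \<open>{K..n}\<close> of the anti-clustering condition contains the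
      fixed window \<open>{K..m}\<close> as soon as \<open>n \<ge> m\<close>.\<close>
    have "\<forall>\<^sub>F n in sequentially. ?I (sel n) / tail_prob (sel n) \<le> b * (tail_prob (\<delta> * sel n) / tail_prob (sel n))"
      using K sel eventually_ge_at_top[of m]
    proof eventually_elim
      case (elim n)
      let ?x = "sel n"
      have x: "?x > 0"
        using elim(2) pos[of n] by auto
      have "?I ?x \<le> (\<integral>\<omega>. indicator {\<omega> \<in> space M. (\<exists>i\<in>{K..n}. norm (X (int i) \<omega>) > ?x * \<delta>) \<and>
          norm (X 0 \<omega>) > ?x * \<delta>} \<omega> \<partial>M)"
      proof (rule integral_mono)
        show "integrable M (\<lambda>\<omega>. indicator {\<omega> \<in> space M. norm (X 0 \<omega>) > ?x} \<omega> *
            \<phi> (?W (\<lambda>t \<omega>. X t \<omega> /\<^sub>R ?x) \<omega>))"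
          by (rule integrable_const_bound[of _ 1])
             (use \<phi>_nonneg \<phi>_le in \<open>auto simp: indicator_def\<close>)
        show "integrable M (indicat_real {\<omega> \<in> space M. (\<exists>i\<in>{K..n}. norm (X (int i) \<omega>) > ?x * \<delta>) \<and>
            norm (X 0 \<omega>) > ?x * \<delta>})"
          by (intro integrable_real_indicator) (auto simp: emeasure_eq_measure)
        fix \<omega> assume \<omega>: "\<omega> \<in> space M"
        show "indicator {\<omega> \<in> space M. norm (X 0 \<omega>) > ?x} \<omega> * \<phi> (?W (\<lambda>t \<omega>. X t \<omega> /\<^sub>R ?x) \<omega>)
          \<le> indicator {\<omega> \<in> space M. (\<exists>i\<in>{K..n}. norm (X (int i) \<omega>) > ?x * \<delta>) \<and>
          norm (X 0 \<omega>) > ?x * \<delta>} \<omega>" (is "?l \<le> ?r")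
        proof (cases "norm (X 0 \<omega>) > ?x \<and> \<phi> (?W (\<lambda>t \<omega>. X t \<omega> /\<^sub>R ?x) \<omega>) \<noteq> 0")
          case True
          then obtain i where i: "i \<in> {K..m}" "norm (?W (\<lambda>t \<omega>. X t \<omega> /\<^sub>R ?x) \<omega> (int i)) > \<delta>"
            using \<phi>_pos by blast
          then have "norm (X (int i) \<omega>) > ?x * \<delta>"
            using x by (simp add: window_def field_simps)
          moreover have "?x * \<delta> \<le> ?x"
            using x \<delta> by (simp add: mult_le_cancel_left1)
          moreover have "i \<in> {K..n}"
            using i elim(3) by auto
          ultimately have "?r = 1"
            using True \<omega> by (auto simp: indicator_def)
          moreover have "?l \<le> 1"
            using \<phi>_le by (auto simp: indicator_def)
          ultimately show ?thesis
            by simp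
        next
          case False
          then have "?l = 0"
            by auto
          then show ?thesis
            by (rule ord_eq_le_trans) (rule indicator_pos_le)
        qed
      qed
      also have "\<dots> = exceed K n (?x * \<delta>)"
        by (simp add: exceed_def)
      also have "\<dots> \<le> b * tail_prob (?x * \<delta>)"
        using elim by blast
      finally have "?I ?x / tail_prob ?x \<le> b * tail_prob (?x * \<delta>) / tail_prob ?x"
        by (rule divide_right_mono) simp
      then show ?case
        by (simp add: mult.commute)
    qed
    with lim1 lim2 have "(\<integral>\<omega>. \<phi> (?W Y \<omega>) \<partial>N) \<le> b * \<delta> powr (- \<alpha>)"
      by (intro tendsto_le[OF trivial_limit_sequentially])
    moreover have "N.prob {\<omega> \<in> space N. \<exists>i\<in>{K..m}. norm (Y (int i) \<omega>) \<ge> 2 * \<delta>} \<le> (\<integral>\<omega>. \<phi> (?W Y \<omega>) \<partial>N)"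
    proof -
      have "N.prob {\<omega> \<in> space N. \<exists>i\<in>{K..m}. norm (Y (int i) \<omega>) \<ge> 2 * \<delta>}
          = (\<integral>\<omega>. indicator {\<omega> \<in> space N. \<exists>i\<in>{K..m}. norm (Y (int i) \<omega>) \<ge> 2 * \<delta>} \<omega> \<partial>N)"
        by simp
      also have "\<dots> \<le> (\<integral>\<omega>. \<phi> (?W Y \<omega>) \<partial>N)"
      proof (rule integral_mono)
        show "integrable N (\<lambda>\<omega>. \<phi> (?W Y \<omega>))"
          by (rule N.integrable_const_bound[of _ 1]) (use \<phi>_nonneg \<phi>_le in auto)
        show "integrable N (indicat_real {\<omega> \<in> space N. \<exists>i\<in>{K..m}. norm (Y (int i) \<omega>) \<ge> 2 * \<delta>})"
          by (intro integrable_real_indicator) (auto simp: N.emeasure_eq_measure)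
        fix \<omega>
        show "indicator {\<omega> \<in> space N. \<exists>i\<in>{K..m}. norm (Y (int i) \<omega>) \<ge> 2 * \<delta>} \<omega> \<le> \<phi> (?W Y \<omega>)"
        proof (cases "\<exists>i\<in>{K..m}. norm (Y (int i) \<omega>) \<ge> 2 * \<delta>")
          case True
          then obtain i where "i \<in> {K..m}" "norm (?W Y \<omega> (int i)) \<ge> 2 * \<delta>"
            by (auto simp: window_def)
          then have "\<phi> (?W Y \<omega>) = 1"
            by (rule \<phi>_eq_1)
          then show ?thesis
            by (simp add: indicator_def)
        next
          case False
          then show ?thesis
            using \<phi>_nonneg by (simp add: indicator_def)
        qed
      qed
      finally show ?thesis .
    qed
    ultimately show ?thesis
      by linarith
  qed
  then show ?thesis
    by blast
qed

text \<open>The bounds do not depend on the horizon, so continuity from below extends them to all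
  times beyond \<open>K\<close>, and infinitely many exceedances have probability 0. Dividing by
  \<open>norm (Y 0) > 1\<close> only decreases the norms.\<close>

lemma AE_\<Theta>_tendsto_0:
  fixes \<Lambda> :: "nat \<Rightarrow> real set"
  assumes pos: "\<And>n. \<Lambda> n \<subseteq> {0<..}" and inf: "filterlim (\<lambda>n. Inf (\<Lambda> n)) at_top sequentially"
    and ac: "uniform_anti_clustering M X \<Lambda>"
  shows "AE \<omega> in N. (\<lambda>i. \<Theta> (int i) \<omega>) \<longlonglongrightarrow> 0"
proof -
  have small: "AE \<omega> in N. \<exists>K. \<forall>i\<ge>K. norm (Y (int i) \<omega>) < 2 * \<delta>" if \<delta>: "0 < \<delta>" "\<delta> \<le> 1" for \<delta>
  proof -
    let ?E = "{\<omega> \<in> space N. \<forall>K. \<exists>i\<in>{K..}. norm (Y (int i) \<omega>) \<ge> 2 * \<delta>}"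
    have "N.prob ?E \<le> 0 + e" if "e > 0" for e
    proof -
      \<comment> \<open>The constant \<open>b\<close> is chosen to absorb the factor
        \<open>\<delta> powr (- \<alpha>)\<close>, so that the bound becomes
        \<open>e\<close>.\<close>
      have "e * \<delta> powr \<alpha> > 0"
        using that \<delta> by simp
      from prob_Y_exceed_le[OF pos inf ac \<delta> this] obtain K where
        K: "\<And>m. N.prob {\<omega> \<in> space N. \<exists>i\<in>{K..m}. norm (Y (int i) \<omega>) \<ge> 2 * \<delta>}
          \<le> e * \<delta> powr \<alpha> * \<delta> powr (- \<alpha>)"
        by blast
      let ?A = "\<lambda>m. {\<omega> \<in> space N. \<exists>i\<in>{K..m}. norm (Y (int i) \<omega>) \<ge> 2 * \<delta>}"
      have "(\<lambda>m. N.prob (?A m)) \<longlonglongrightarrow> N.prob (\<Union>m. ?A m)"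
      proof (rule N.finite_Lim_measure_incseq)
        show "range ?A \<subseteq> sets N"
          by auto
        show "incseq ?A"
        proof (rule incseq_SucI)
          fix m
          have "{K..m} \<subseteq> {K..Suc m}"
            by auto
          then show "?A m \<subseteq> ?A (Suc m)"
            by blast
        qed
      qed
      then have "N.prob (\<Union>m. ?A m) \<le> e * \<delta> powr \<alpha> * \<delta> powr (- \<alpha>)"
        using K by (intro LIMSEQ_le_const2) auto
      moreover have "\<delta> powr \<alpha> * \<delta> powr (- \<alpha>) = 1"
        using \<delta> by (simp flip: powr_add)
      moreover have "N.prob ?E \<le> N.prob (\<Union>m. ?A m)"
      proof (rule N.finite_measure_mono)
        show "?E \<subseteq> (\<Union>m. ?A m)"
        proof
          fix \<omega> assume "\<omega> \<in> ?E"
          then obtain i where "i \<ge> K" "norm (Y (int i) \<omega>) \<ge> 2 * \<delta>" "\<omega> \<in> space N"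
            by blast
          then have "\<omega> \<in> ?A i"
            by auto
          then show "\<omega> \<in> (\<Union>m. ?A m)"
            by blast
        qed
      qed auto
      ultimately show ?thesis
        by (simp add: mult.assoc)
    qed
    then have "N.prob ?E \<le> 0"
      by (rule field_le_epsilon)
    then have "N.prob ?E = 0"
      by (simp add: antisym)
    moreover have "?E \<in> sets N"
      by measurable
    ultimately have "?E \<in> null_sets N"
      by (auto simp: null_sets_def N.emeasure_eq_measure)
    from AE_not_in[OF this] AE_space show ?thesis
    proof eventually_elim
      case (elim \<omega>)
      then obtain K where "\<forall>i\<in>{K..}. \<not> norm (Y (int i) \<omega>) \<ge> 2 * \<delta>"
        by blast
      then show ?case
        by (auto simp: not_le)
    qed
  qed
  have "AE \<omega> in N. \<forall>j. \<exists>K. \<forall>i\<ge>K. norm (Y (int i) \<omega>) < 2 * inverse (real (Suc j))"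
    unfolding AE_all_countable by (intro allI small) (auto simp: field_simps)
  then show ?thesis
    using AE_norm_Y0_gt_1
  proof eventually_elim
    case (elim \<omega>)
    show ?case
    proof (rule LIMSEQ_I)
      fix r :: real assume "r > 0"
      then obtain j where j: "inverse (real (Suc j)) < r / 2"
        using reals_Archimedean[of "r / 2"] by auto
      obtain K where K: "\<And>i. i \<ge> K \<Longrightarrow> norm (Y (int i) \<omega>) < 2 * inverse (real (Suc j))"
        using elim(1) by blast
      have "norm (\<Theta> (int i) \<omega> - 0) < r" if "i \<ge> K" for i
      proof -
        have "norm (\<Theta> (int i) \<omega>) = norm (Y (int i) \<omega>) / norm (Y 0 \<omega>)"
          by (simp add: \<Theta>_def divide_inverse_commute)
        also have "\<dots> \<le> norm (Y (int i) \<omega>) / 1"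
          using elim(2) by (intro divide_left_mono) auto
        finally show ?thesis
          using K[OF that] j by simp
      qed
      then show "\<exists>no. \<forall>n\<ge>no. norm (\<Theta> (int n) \<omega> - 0) < r"
        by blast
    qed
  qed
qed

end

section \<open>Telescoping and comparison of the increments\<close>

context tail_functional
begin

text \<open>Stationarity moves the block over times 1 to \<open>n + 1\<close> to times 0 to
  \<open>n\<close>; removing time 0 leaves the block over 1 to \<open>n\<close> and splits off
  \<open>incr n\<close>.\<close>

lemma integral_block_telescope:
  assumes st: "strictly_stationary M X"
  shows "(\<integral>\<omega>. block 1 n (\<lambda>t. X t \<omega> /\<^sub>R x) \<partial>M) = (\<Sum>m<n. \<integral>\<omega>. incr m (\<lambda>t. X t \<omega> /\<^sub>R x) \<partial>M)"
proof (induction n)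
  case (Suc n)
  have "(\<integral>\<omega>. block 1 (Suc n) (\<lambda>t. X t \<omega> /\<^sub>R x) \<partial>M)
      = (\<integral>\<omega>. block 0 (Suc n) (\<lambda>t. X (t + 1) \<omega> /\<^sub>R x) \<partial>M)"
  proof (rule Bochner_Integration.integral_cong)
    show "block 1 (Suc n) (\<lambda>t. X t \<omega> /\<^sub>R x) = block 0 (Suc n) (\<lambda>t. X (t + 1) \<omega> /\<^sub>R x)" for \<omega>
      using block_shift[of 0 "Suc n" "\<lambda>t. X t \<omega> /\<^sub>R x" 1] by simp
  qed simp
  also have "\<dots> = (\<integral>\<omega>. block 0 (Suc n) (\<lambda>t. X t \<omega> /\<^sub>R x) \<partial>M)"
    using integral_stationary[OF st, of "\<lambda>v. block 0 (Suc n) (\<lambda>t. v t /\<^sub>R x)" 1] by simp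
  also have "\<dots> = (\<integral>\<omega>. incr n (\<lambda>t. X t \<omega> /\<^sub>R x) + block 1 n (\<lambda>t. X t \<omega> /\<^sub>R x) \<partial>M)"
    by (simp add: incr_def)
  also have "\<dots> = (\<integral>\<omega>. incr n (\<lambda>t. X t \<omega> /\<^sub>R x) \<partial>M) + (\<integral>\<omega>. block 1 n (\<lambda>t. X t \<omega> /\<^sub>R x) \<partial>M)"
    by (intro Bochner_Integration.integral_add integrable_bounded_functional[OF _ norm_incr_le]
        integrable_bounded_functional[OF _ norm_block_le]) measurable
  finally show ?case
    by (simp add: Suc.IH)
qed simp

text \<open>The increments agree, both being 0, unless \<open>norm (X 0) > x * \<epsilon>\<close>;
  for \<open>m \<ge> k\<close> they also agree if no exceedance occurs from time \<open>k\<close> to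
  \<open>n\<close>. Each is bounded by \<open>2 * C\<close>, hence the factor \<open>4 * C\<close>
  times the probability of the exceptional event.\<close>

lemma norm_integral_incr_diff_le:
  assumes x: "x > 0" and "m < n"
  shows "norm ((\<integral>\<omega>. incr m (\<lambda>t. X t \<omega> /\<^sub>R x) \<partial>M) - (\<integral>\<omega>. incr k (\<lambda>t. X t \<omega> /\<^sub>R x) \<partial>M))
    \<le> 4 * C * ((if m < k then tail_prob (x * \<epsilon>) else 0) + exceed k n (x * \<epsilon>))"
proof -
  let ?Z = "\<lambda>\<omega> t. X t \<omega> /\<^sub>R x"
  let ?A = "if m < k then {\<omega> \<in> space M. norm (X 0 \<omega>) > x * \<epsilon>}
    else {\<omega> \<in> space M. (\<exists>i\<in>{k..n}. norm (X (int i) \<omega>) > x * \<epsilon>) \<and> norm (X 0 \<omega>) > x * \<epsilon>}"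
  have A [measurable]: "?A \<in> events"
    by auto
  have "(\<integral>\<omega>. incr m (?Z \<omega>) \<partial>M) - (\<integral>\<omega>. incr k (?Z \<omega>) \<partial>M) = (\<integral>\<omega>. incr m (?Z \<omega>) - incr k (?Z \<omega>) \<partial>M)"
    by (intro Bochner_Integration.integral_diff[symmetric] integrable_bounded_functional[OF _ norm_incr_le]) measurable
  also have "norm \<dots> \<le> (\<integral>\<omega>. 4 * C * indicator ?A \<omega> \<partial>M)"
  proof (rule norm_integral_le_integral)
    show "integrable M (\<lambda>\<omega>. incr m (?Z \<omega>) - incr k (?Z \<omega>))"
      by (intro Bochner_Integration.integrable_diff integrable_bounded_functional[OF _ norm_incr_le]) measurable
    show "integrable M (\<lambda>\<omega>. 4 * C * indicator ?A \<omega>)"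
      using A by (intro integrable_mult_right integrable_real_indicator) (auto simp: emeasure_eq_measure)
    fix \<omega> assume \<omega>: "\<omega> \<in> space M"
    show "norm (incr m (?Z \<omega>) - incr k (?Z \<omega>)) \<le> 4 * C * indicator ?A \<omega>"
    proof (cases "\<omega> \<in> ?A")
      case True
      have "norm (incr m (?Z \<omega>) - incr k (?Z \<omega>)) \<le> 2 * C + 2 * C"
        using norm_incr_le by (intro norm_triangle_le_diff add_mono)
      then show ?thesis
        using True by simp
    next
      case False
      have "incr m (?Z \<omega>) = incr k (?Z \<omega>)"
      proof (cases "norm (X 0 \<omega>) > x * \<epsilon>")
        case gt: True
        with False \<omega> have "k \<le> m" and le: "\<And>i. k \<le> i \<Longrightarrow> i \<le> n \<Longrightarrow> norm (X (int i) \<omega>) \<le> x * \<epsilon>"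
          by (auto split: if_splits simp: not_less)
        then show ?thesis
          using x \<open>m < n\<close> by (intro incr_eq) (auto simp: field_simps)
      next
        case False
        then have "norm (?Z \<omega> 0) \<le> \<epsilon>"
          using x by (simp add: field_simps)
        then show ?thesis
          by (simp only: incr_eq_0)
      qed
      then show ?thesis
        using C_pos by simp
    qed
  qed
  also have "\<dots> = 4 * C * prob ?A"
    using A by (simp add: sets.Int_space_eq2)
  also have "\<dots> \<le> 4 * C * ((if m < k then tail_prob (x * \<epsilon>) else 0) + exceed k n (x * \<epsilon>))"
    using C_pos by (intro mult_left_mono) (auto simp: tail_prob_def exceed_def)
  finally show ?thesis .
qed

text \<open>Only the indices below \<open>k\<close> pay the full tail probability; this part is of
  order \<open>k\<close>, not \<open>n\<close>, and disappears after normalisation. The joint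
  exceedance is paid by all \<open>n\<close> indices.\<close>

lemma norm_integral_f_diff_le:
  assumes st: "strictly_stationary M X" and x: "x > 0"
  shows "norm ((\<integral>\<omega>. f (map (\<lambda>i. X (int i) \<omega> /\<^sub>R x) [1..<n + 1]) \<partial>M)
      - of_nat n * (\<integral>\<omega>. incr k (\<lambda>t. X t \<omega> /\<^sub>R x) \<partial>M))
    \<le> 4 * C * (real k * tail_prob (x * \<epsilon>) + real n * exceed k n (x * \<epsilon>))"
proof -
  let ?E = "\<lambda>m. \<integral>\<omega>. incr m (\<lambda>t. X t \<omega> /\<^sub>R x) \<partial>M"
  have "map (\<lambda>i. X (int i) \<omega> /\<^sub>R x) [1..<n + 1] = map (\<lambda>i. X (1 + int i) \<omega> /\<^sub>R x) [0..<n]" for \<omega>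
    by (intro nth_equalityI) (auto simp del: upt_Suc simp: algebra_simps)
  then have "(\<integral>\<omega>. f (map (\<lambda>i. X (int i) \<omega> /\<^sub>R x) [1..<n + 1]) \<partial>M) = (\<Sum>m<n. ?E m)"
    using integral_block_telescope[OF st, of n x] by (simp only: block_def)
  then have "norm ((\<integral>\<omega>. f (map (\<lambda>i. X (int i) \<omega> /\<^sub>R x) [1..<n + 1]) \<partial>M) - of_nat n * ?E k)
      = norm (\<Sum>m<n. ?E m - ?E k)"
    by (simp add: sum_subtractf)
  also have "\<dots> \<le> (\<Sum>m<n. 4 * C * ((if m < k then tail_prob (x * \<epsilon>) else 0) + exceed k n (x * \<epsilon>)))"
    by (rule order_trans[OF norm_sum sum_mono]) (rule norm_integral_incr_diff_le[OF x], simp)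
  also have "\<dots> = 4 * C * ((\<Sum>m<n. if m < k then tail_prob (x * \<epsilon>) else 0) + real n * exceed k n (x * \<epsilon>))"
    by (simp add: sum.distrib flip: sum_distrib_left)
  also have "(\<Sum>m<n. if m < k then tail_prob (x * \<epsilon>) else 0) \<le> real k * tail_prob (x * \<epsilon>)"
  proof -
    have "(\<Sum>m<n. if m < k then tail_prob (x * \<epsilon>) else 0) = (\<Sum>m\<in>{..<n} \<inter> {m. m < k}. tail_prob (x * \<epsilon>))"
      by (subst sum.inter_restrict) auto
    also have "\<dots> \<le> (\<Sum>m<k. tail_prob (x * \<epsilon>))"
      by (rule sum_mono2) auto
    finally show ?thesis
      by simp
  qed
  finally show ?thesis
    using C_pos by simp
qed

section \<open>Infinite sequences and the passage to the limit\<close>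

lemma seq_ext_meas [measurable]: "seq_ext \<epsilon> f \<in> borel_measurable borel"
proof -
  let ?P = "\<lambda>u :: nat \<Rightarrow> 'a. \<exists>l. \<forall>i. l \<le> i \<longrightarrow> norm (u i) \<le> \<epsilon>"
  \<comment> \<open>On the domain of the extension the values of \<open>restriction f l\<close> are
    eventually constant in \<open>l\<close>, so \<open>seq_ext\<close> is a pointwise limit of
    measurable functions.\<close>
  have "seq_ext \<epsilon> f u = lim (\<lambda>l. if ?P u then restriction f l u else 0)" for u
  proof (cases "?P u")
    case True
    define l where "l = (LEAST l. \<forall>i\<ge>l. norm (u i) \<le> \<epsilon>)"
    have l: "\<forall>i\<ge>l. norm (u i) \<le> \<epsilon>"
      unfolding l_def by (rule LeastI_ex) (use True in auto)
    have "restriction f m u = restriction f l u" if "m \<ge> l" for m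
      using block_trim_right[of l m "\<lambda>i. u (nat i)" 0] l that by (simp add: block_def restriction_def)
    then have "(\<lambda>m. restriction f m u) \<longlonglongrightarrow> restriction f l u"
      by (intro tendsto_eventually eventually_sequentiallyI[of l])
    then have "lim (\<lambda>m. restriction f m u) = restriction f l u"
      by (rule limI)
    then show ?thesis
      using True by (simp add: seq_ext_def l_def)
  next
    case False
    then show ?thesis
      by (simp only: seq_ext_def if_False) simp
  qed
  moreover have "(\<lambda>u. lim (\<lambda>l. if ?P u then restriction f l u else 0)) \<in> borel_measurable borel"
    by measurable
  ultimately show ?thesis
    by presburger
qed

text \<open>The least admissible cut is at most \<open>m\<close>, and the block of length
  \<open>l\<close> can be trimmed down to it.\<close>

lemma block_eq_seq_ext:
  assumes small: "\<And>i. m \<le> i \<Longrightarrow> norm (v (s + int i)) \<le> \<epsilon>" and "m \<le> l"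
  shows "block s l v = seq_ext \<epsilon> f (\<lambda>i. v (s + int i))"
proof -
  define L where "L = (LEAST l. \<forall>i\<ge>l. norm (v (s + int i)) \<le> \<epsilon>)"
  have ex: "\<forall>i\<ge>m. norm (v (s + int i)) \<le> \<epsilon>"
    using small by simp
  have L: "\<forall>i\<ge>L. norm (v (s + int i)) \<le> \<epsilon>"
    unfolding L_def by (rule LeastI) (rule ex)
  have "L \<le> m"
    unfolding L_def by (rule Least_le) (rule ex)
  then have "block s l v = block s L v"
    using \<open>m \<le> l\<close> L by (intro block_trim_right) auto
  also have "\<dots> = restriction f L (\<lambda>i. v (s + int i))"
    by (simp add: block_def restriction_def)
  also have "\<dots> = seq_ext \<epsilon> f (\<lambda>i. v (s + int i))"
    unfolding seq_ext_def L_def using ex by auto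
  finally show ?thesis .
qed

definition incr_lim :: "(int \<Rightarrow> 'a) \<Rightarrow> complex" where
  "incr_lim v = seq_ext \<epsilon> f (\<lambda>t. v (int t)) - seq_ext \<epsilon> f (\<lambda>t. v (int t + 1))"

lemma incr_lim_meas [measurable]: "incr_lim \<in> borel_measurable borel"
proof -
  have [measurable]: "(\<lambda>v :: int \<Rightarrow> 'a. \<lambda>t :: nat. v (g t)) \<in> borel_measurable borel" for g
    by (rule measurable_coordinatewise_then_product) measurable
  show ?thesis
    unfolding incr_lim_def[abs_def] by measurable
qed

text \<open>The sequence is eventually constant: once \<open>k\<close> lies beyond the last time at
  which the norm exceeds \<open>\<epsilon>\<close>, longer blocks add only small entries.\<close>

lemma incr_tendsto_incr_lim:
  assumes "(\<lambda>i. v (int i)) \<longlonglongrightarrow> 0"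
  shows "(\<lambda>k. incr k v) \<longlonglongrightarrow> incr_lim v"
proof -
  have "\<forall>\<^sub>F i in sequentially. norm (v (int i)) < \<epsilon>"
    using tendsto_norm_zero[OF assms] \<epsilon>_pos by (rule order_tendstoD)
  then obtain m where m: "\<And>i. i \<ge> m \<Longrightarrow> norm (v (int i)) \<le> \<epsilon>"
    by (auto simp: eventually_at_top_linorder intro: less_imp_le)
  have m': "norm (v (1 + int i)) \<le> \<epsilon>" if "i \<ge> m" for i
    using m[of "Suc i"] that by simp
  have "incr k v = incr_lim v" if "k \<ge> m" for k
  proof -
    have "block 0 (Suc k) v = seq_ext \<epsilon> f (\<lambda>i. v (0 + int i))"
      by (rule block_eq_seq_ext[of m]) (use m that in auto)
    moreover have "block 1 k v = seq_ext \<epsilon> f (\<lambda>i. v (1 + int i))"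
      by (rule block_eq_seq_ext[of m]) (use m' that in auto)
    ultimately show ?thesis
      by (simp add: incr_def incr_lim_def add.commute)
  qed
  then show ?thesis
    by (intro tendsto_eventually) (auto simp: eventually_at_top_linorder)
qed

definition incr_lim_mean :: "real \<Rightarrow> complex" where
  "incr_lim_mean y = (\<integral>\<omega>. incr_lim (\<lambda>t. y *\<^sub>R \<Theta> t \<omega>) \<partial>N)"

lemma incr_lim_mean_meas [measurable]: "incr_lim_mean \<in> borel_measurable borel"
  unfolding incr_lim_mean_def[abs_def] by (rule borel_measurable_scaled_mean) measurable

lemma incr_mean_tendsto:
  assumes \<Theta>0: "AE \<omega> in N. (\<lambda>i. \<Theta> (int i) \<omega>) \<longlonglongrightarrow> 0"
  shows "(\<lambda>k. incr_mean k y) \<longlonglongrightarrow> incr_lim_mean y"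
  unfolding incr_mean_def incr_lim_mean_def
proof (rule integral_dominated_convergence[where w="\<lambda>_. 2 * C"])
  show "AE \<omega> in N. (\<lambda>k. incr k (\<lambda>t. y *\<^sub>R \<Theta> t \<omega>)) \<longlonglongrightarrow> incr_lim (\<lambda>t. y *\<^sub>R \<Theta> t \<omega>)"
    using \<Theta>0
  proof eventually_elim
    case (elim \<omega>)
    show ?case
      using tendsto_scaleR[OF tendsto_const[of y] elim] by (intro incr_tendsto_incr_lim) simp
  qed
qed (auto simp: norm_incr_le)

text \<open>The constant \<open>2 * C\<close> is not integrable for the measure on
  \<open>{0<..}\<close>, so dominated convergence is carried out under the Pareto law. Vanishing on
  \<open>(0, \<epsilon>]\<close> passes from the increments to their limit, which allows the return
  to \<open>{0<..}\<close>.\<close>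

lemma integral_incr_mean_tendsto:
  assumes \<Theta>0: "AE \<omega> in N. (\<lambda>i. \<Theta> (int i) \<omega>) \<longlonglongrightarrow> 0"
  shows "(\<lambda>k. LINT y:{0<..}|lborel. (\<alpha> * y powr (- \<alpha> - 1)) *\<^sub>R incr_mean k y)
    \<longlonglongrightarrow> (LINT y:{0<..}|lborel. (\<alpha> * y powr (- \<alpha> - 1)) *\<^sub>R incr_lim_mean y)"
proof -
  interpret P: prob_space "pareto \<epsilon> \<alpha>"
    by (rule prob_space_pareto[OF \<epsilon>_pos \<alpha>_pos])
  have lim: "(\<lambda>k. incr_mean k y) \<longlonglongrightarrow> incr_lim_mean y" for y
    by (rule incr_mean_tendsto[OF \<Theta>0])
  have "(\<lambda>k. integral\<^sup>L (pareto \<epsilon> \<alpha>) (incr_mean k)) \<longlonglongrightarrow> integral\<^sup>L (pareto \<epsilon> \<alpha>) incr_lim_mean"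
    by (rule integral_dominated_convergence[where w="\<lambda>_. 2 * C"]) (auto simp: lim norm_incr_mean_le cong: measurable_cong_sets)
  moreover have "incr_lim_mean y = 0" if "0 < y" "y \<le> \<epsilon>" for y
  proof -
    have "(\<lambda>k. 0) \<longlonglongrightarrow> incr_lim_mean y"
      using lim[of y] by (simp add: incr_mean_eq_0 that)
    then show ?thesis
      by (rule LIMSEQ_unique[OF _ tendsto_const])
  qed
  ultimately have "(\<lambda>k. (\<epsilon> powr \<alpha>) *\<^sub>R (LINT y:{0<..}|lborel. (\<alpha> * y powr (- \<alpha> - 1)) *\<^sub>R incr_mean k y))
    \<longlonglongrightarrow> (\<epsilon> powr \<alpha>) *\<^sub>R (LINT y:{0<..}|lborel. (\<alpha> * y powr (- \<alpha> - 1)) *\<^sub>R incr_lim_mean y)"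
    by (simp add: integral_pareto[OF \<epsilon>_pos \<alpha>_pos] incr_mean_eq_0)
  from tendsto_scaleR[OF tendsto_const[of "inverse (\<epsilon> powr \<alpha>)"] this] show ?thesis
    using \<epsilon>_pos by simp
qed

text \<open>Three errors are added: replacing all increments by the \<open>k\<close>-th, the tail
  limit for this fixed \<open>k\<close>, and the distance of its limit integral from the one for
  \<open>k = \<infinity>\<close>. They receive \<open>e / 2\<close>, \<open>e / 4\<close> and
  \<open>e / 4\<close>.\<close>

lemma uniform_limit_on:
  fixes \<Lambda> :: "nat \<Rightarrow> real set"
  assumes st: "strictly_stationary M X"
    and pos: "\<And>n. \<Lambda> n \<subseteq> {0<..}" and inf: "filterlim (\<lambda>n. Inf (\<Lambda> n)) at_top sequentially"
    and ac: "uniform_anti_clustering M X \<Lambda>" and e: "e > 0"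
  shows "\<forall>\<^sub>F n in sequentially. \<forall>x\<in>\<Lambda> n. norm (
      (\<integral>\<omega>. f (map (\<lambda>i. X (int i) \<omega> /\<^sub>R x) [1..<n + 1]) \<partial>M) / complex_of_real (real n * tail_prob x)
      - (LINT y:{0<..}|lborel. (\<alpha> * y powr (- \<alpha> - 1)) *\<^sub>R incr_lim_mean y)) \<le> e"
proof -
  let ?L = "\<lambda>k. LINT y:{0<..}|lborel. (\<alpha> * y powr (- \<alpha> - 1)) *\<^sub>R incr_mean k y"
  let ?L' = "LINT y:{0<..}|lborel. (\<alpha> * y powr (- \<alpha> - 1)) *\<^sub>R incr_lim_mean y"
  \<comment> \<open>\<open>R\<close> eventually exceeds the ratio of the tail probabilities at
    \<open>\<epsilon> * x\<close> and \<open>x\<close>. With both \<open>real k / real n\<close> and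
    the anti-clustering constant at most \<open>b\<close>, the comparison error is at most
    \<open>4 * C * (b + b) * R = e / 2\<close>.\<close>
  define R where "R = \<epsilon> powr (- \<alpha>) + 1"
  define b where "b = e / (16 * C * R)"
  have R: "R > 0"
    by (simp add: R_def add_nonneg_pos)
  then have b: "b > 0"
    using e C_pos by (simp add: b_def)
  obtain K where K: "\<And>k. k \<ge> K \<Longrightarrow>
      \<forall>\<^sub>F n in sequentially. \<forall>x\<in>\<Lambda> n. exceed k n (x * \<epsilon>) \<le> b * tail_prob (x * \<epsilon>)"
    using uniform_exceed_le[OF ac \<epsilon>_pos b] by blast
  have "\<forall>\<^sub>F k in sequentially. dist (?L k) ?L' < e / 4"
    using integral_incr_mean_tendsto[OF AE_\<Theta>_tendsto_0[OF pos inf ac]] e by (intro tendstoD) auto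
  then have "\<forall>\<^sub>F k in sequentially. K \<le> k \<and> dist (?L k) ?L' < e / 4"
    by (intro eventually_conj eventually_ge_at_top)
  then obtain k where k: "k \<ge> K" "dist (?L k) ?L' < e / 4"
    using eventually_happens trivial_limit_sequentially by blast
  \<comment> \<open>With \<open>k\<close> fixed, every requirement on \<open>x\<close> is a
    statement about large \<open>x\<close> and thus holds simultaneously on the whole of
    \<open>\<Lambda> n\<close> for large \<open>n\<close>.\<close>
  have "\<forall>\<^sub>F x in at_top. x > 0 \<and> tail_prob x > 0 \<and> tail_prob (\<epsilon> * x) / tail_prob x < R \<and>
      dist ((\<integral>\<omega>. incr k (\<lambda>t. X t \<omega> /\<^sub>R x) \<partial>M) / complex_of_real (tail_prob x)) (?L k) < e / 4"
    using order_tendstoD(2)[OF tail_prob_ratio[OF \<epsilon>_pos], of R] tendstoD[OF incr_tendsto[of k], of "e / 4"] e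
    by (intro eventually_conj eventually_gt_at_top tail_prob_pos) (auto simp: R_def)
  note ev_x = eventually_ge_on[OF pos inf this]
  have "(\<lambda>n. real k / real n) \<longlonglongrightarrow> 0"
    by (rule lim_const_over_n)
  then have "\<forall>\<^sub>F n in sequentially. real k / real n < b"
    using b by (rule order_tendstoD)
  with ev_x K[OF k(1)] eventually_gt_at_top[of 0] show ?thesis
  proof eventually_elim
    case (elim n)
    show ?case
    proof
      fix x assume x: "x \<in> \<Lambda> n"
      let ?F = "\<integral>\<omega>. f (map (\<lambda>i. X (int i) \<omega> /\<^sub>R x) [1..<n + 1]) \<partial>M"
      let ?E = "\<integral>\<omega>. incr k (\<lambda>t. X t \<omega> /\<^sub>R x) \<partial>M"
      have xp: "x > 0" and tail_pos: "tail_prob x > 0" and ratio: "tail_prob (\<epsilon> * x) / tail_prob x < R"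
        and E: "dist (?E / complex_of_real (tail_prob x)) (?L k) < e / 4"
        using elim(1) x by auto
      have n: "real n > 0"
        using elim(3) by simp
      have "norm (?F / complex_of_real (real n * tail_prob x) - ?E / complex_of_real (tail_prob x))
          = norm ((?F - of_nat n * ?E) / complex_of_real (real n * tail_prob x))"
        using n tail_pos by (simp add: field_simps)
      also have "\<dots> = norm (?F - of_nat n * ?E) / (real n * tail_prob x)"
        using n tail_pos by (simp add: norm_divide norm_mult)
      also have "\<dots> \<le> 4 * C * (real k * tail_prob (x * \<epsilon>) + real n * exceed k n (x * \<epsilon>)) / (real n * tail_prob x)"
        using n tail_pos by (intro divide_right_mono norm_integral_f_diff_le[OF st xp]) auto
      also have "\<dots> \<le> 4 * C * (real k * tail_prob (x * \<epsilon>) + real n * (b * tail_prob (x * \<epsilon>))) / (real n * tail_prob x)"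
        using n tail_pos C_pos elim(2) x by (intro divide_right_mono mult_left_mono add_left_mono) auto
      also have "\<dots> = 4 * C * ((real k / real n + b) * (tail_prob (\<epsilon> * x) / tail_prob x))"
        using n tail_pos by (simp add: field_simps)
      also have "\<dots> \<le> 4 * C * ((b + b) * R)"
        using elim(4) b C_pos ratio tail_prob_nonneg[of "\<epsilon> * x"] tail_pos n
        by (intro mult_left_mono mult_mono add_right_mono less_imp_le[OF ratio]) auto
      also have "\<dots> = e / 2"
        using C_pos R by (simp add: b_def)
      finally have "norm (?F / complex_of_real (real n * tail_prob x) - ?E / complex_of_real (tail_prob x)) \<le> e / 2" .
      then have "dist (?F / complex_of_real (real n * tail_prob x)) (?E / complex_of_real (tail_prob x)) \<le> e / 2"
        by (simp add: dist_norm)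
      then have "dist (?F / complex_of_real (real n * tail_prob x)) ?L' \<le> e"
        using E k(2) dist_triangle[of "?F / complex_of_real (real n * tail_prob x)" ?L' "?E / complex_of_real (tail_prob x)"]
          dist_triangle[of "?E / complex_of_real (tail_prob x)" ?L' "?L k"] by linarith
      then show "norm (?F / complex_of_real (real n * tail_prob x) - ?L') \<le> e"
        by (simp add: dist_norm)
    qed
  qed
qed

end

theorem theorem3p1:
  fixes M :: "'w measure" and N :: "'v measure"
    and X :: "int \<Rightarrow> 'w \<Rightarrow> real ^ 'd" and \<Theta> :: "int \<Rightarrow> 'v \<Rightarrow> real ^ 'd"
    and \<alpha> \<epsilon> :: real and \<Lambda> :: "nat \<Rightarrow> real set"
    and f :: "(real ^ 'd) list \<Rightarrow> complex"
  assumes "prob_space M"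
    and "\<And>t. X t \<in> borel_measurable M"
    and "strictly_stationary M X"
    and "\<alpha> > 0"
    and "regularly_varying_sequence M \<alpha> X"
    and "spectral_tail_process M \<alpha> X N \<Theta>"
    and "\<And>n. \<Lambda> n \<in> sets borel"
    and "\<And>n. \<Lambda> n \<subseteq> {0<..}"
    and "filterlim (\<lambda>n. Inf (\<Lambda> n)) at_top sequentially"
    and "(\<lambda>n. real n * \<P>(\<omega> in M. norm (X 0 \<omega>) > Inf (\<Lambda> n))) \<longlonglongrightarrow> 0"
    and "uniform_anti_clustering M X \<Lambda>"
    and "\<epsilon> > 0"
    and "condition_C N \<Theta> \<epsilon> f"
  shows "(\<lambda>n. SUP x \<in> \<Lambda> n. ennreal (norm (
      (LINT \<omega>|M. f (map (\<lambda>i. X (int i) \<omega> /\<^sub>R x) [1..<n + 1]))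
        / complex_of_real (real n * \<P>(\<omega> in M. norm (X 0 \<omega>) > x))
      - (LINT y:{0<..}|lborel. (\<alpha> * y powr (- \<alpha> - 1)) *\<^sub>R
          (LINT \<omega>|N. seq_ext \<epsilon> f (\<lambda>t. y *\<^sub>R \<Theta> (int t) \<omega>)
                     - seq_ext \<epsilon> f (\<lambda>t. y *\<^sub>R \<Theta> (int t + 1) \<omega>))))))
    \<longlonglongrightarrow> 0"
proof -
  obtain Y where Y: "tail_process M \<alpha> X N Y" "\<Theta> = (\<lambda>t \<omega>. Y t \<omega> /\<^sub>R norm (Y 0 \<omega>))"
    using assms(6) by (auto simp: spectral_tail_process_def)
  obtain C where C: "\<And>xs. norm (f xs) \<le> C"
    using assms(13) by (auto simp: condition_C_def)
  interpret prob_space M by fact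
  interpret T: tail_process_space M X \<alpha> N Y
    by unfold_locales (use assms Y in auto)
  have \<Theta>: "\<Theta> = T.\<Theta>"
    by (auto simp: Y T.\<Theta>_def fun_eq_iff)
  interpret T: tail_functional M X \<alpha> N Y \<epsilon> "\<bar>C\<bar> + 1" f
  proof
    show "norm (f xs) \<le> \<bar>C\<bar> + 1" for xs
      using C[of xs] by linarith
  qed (use assms \<Theta> in auto)
  show ?thesis
  \<comment> \<open>The supremum is formed in \<open>ennreal\<close>, so it exists without a
    boundedness proof, and a bound \<open>e\<close> valid for each \<open>x\<close> in
    \<open>\<Lambda> n\<close> suffices.\<close>
  proof (rule tendsto_0_ennrealI)
    fix e :: real assume "e > 0"
    from T.uniform_limit_on[OF assms(3,8,9,11) this]
    show "\<forall>\<^sub>F n in sequentially. (SUP x \<in> \<Lambda> n. ennreal (norm (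
      (LINT \<omega>|M. f (map (\<lambda>i. X (int i) \<omega> /\<^sub>R x) [1..<n + 1]))
        / complex_of_real (real n * \<P>(\<omega> in M. norm (X 0 \<omega>) > x))
      - (LINT y:{0<..}|lborel. (\<alpha> * y powr (- \<alpha> - 1)) *\<^sub>R
          (LINT \<omega>|N. seq_ext \<epsilon> f (\<lambda>t. y *\<^sub>R \<Theta> (int t) \<omega>)
                     - seq_ext \<epsilon> f (\<lambda>t. y *\<^sub>R \<Theta> (int t + 1) \<omega>)))))) \<le> ennreal e"
      unfolding T.tail_prob_def T.incr_lim_mean_def T.incr_lim_def \<Theta>
      by eventually_elim (intro SUP_least ennreal_leI, blast)
  qed
qed

end
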